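(* The following bounds hold for the covering waste $W'$ and the shapes $T_1,T_2,T_3$ of Types 1, 2, 3 with parameter $x$ defined in the context. (i) Let $c\le 7$ be a constant. For all sufficiently large $x$ and every $x'$ with $x^{3/4}\le x'\le cx$, the Type 1 rectangle $T_1$ of length $x$ and width $x'$ satisfies $$W'(T_1)\le \bigl((15+c)\sqrt{2}+38\bigr)x^{5/8}.$$ (ii) For every choice of functions $x'=x'(x)\sim 2x^{1/2}$ and $\theta=\theta(x)$ with $0<\theta<\sqrt{2}\,x^{-1/2}$, for all sufficiently large $x$ the corresponding Type 2 trapezoid $T_2$ satisfies $$W'(T_2)\le \Bigl(\tfrac{19}{2}+\tfrac{7}{2}\sqrt{2}\Bigr)x^{5/6}.$$ (iii) For every choice of functions $h=h(x)\sim\frac12 x^{1/2}$ and $\theta=\theta(x)$ with $0<\theta<\sqrt{2}\,x^{-1/2}$, for all sufficiently large $x$ the corresponding Type 3 trapezoid $T_3$ satisfies $$W'(T_3)\le \Bigl(\tfrac{19}{4}+\tfrac{7}{4}\sqrt{2}\Bigr)x^{1/3}.$$ In particular, when $T_1$ is a square of side length $x$ (writing $W'(x)$ for $W'(T_1)$), for all sufficiently large $x$, $$W'(x)\le (16\sqrt{2}+38)\,x^{5/8}.$$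
   Context: For a closed planar region $A$, let $S(A)$ be its area. The covering waste is $$W'(A)=\inf N-S(A),$$ where the infimum is over all finite families of unit squares whose union contains $A$, and $N$ is the number of squares in the family (i.e. their total area counted with multiplicity). Unit squares are squares of side length $1$, allowed in any position and orientation; they may overlap each other. For a square of side length $x$, $W'(A)$ is denoted $W'(x)$. The notation $f(x)\sim g(x)$ means $f(x)/g(x)\to 1$ as $x\to\infty$. Shapes with parameter $x$: Type 1: a rectangle $T_1$ of length $x$ and width $x'$, where $x^{3/4}\le x'\le cx$ with $c\le 7$ a constant. Type 2: a right trapezoid $T_2$ of height $x$ with horizontal parallel top and bottom edges, vertical left side, top edge of length $x'\sim 2x^{1/2}$, and right-hand side making an angle $\theta$ with the vertical, $0<\theta<\sqrt{2}\,x^{-1/2}$, the trapezoid widening downwards (so the bottom edge has length $x'+x\tan\theta$). Type 3 (covering version): a right trapezoid $T_3$ of height $h\sim\frac12x^{1/2}$ with horizontal parallel top and bottom edges, vertical left side, top edge of integer length $a=\lfloor x^{1/3}-\sqrt{2}\,x^{1/6}\rfloor$, and right-hand side making an angle $\theta$ with the vertical, $0<\theta<\sqrt{2}\,x^{-1/2}$, the trapezoid widening downwards (so the bottom edge has length $a+h\tan\theta$). *)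

theory Defs
  imports "HOL-Analysis.Analysis" "HOL-Library.Landau_Symbols"
begin

type_synonym point = "real \<times> real"

text \<open>Closed rectangles, in any position and orientation.\<close>

definition is_rectangle :: "real \<Rightarrow> real \<Rightarrow> point set \<Rightarrow> bool" where
  "is_rectangle l w T \<longleftrightarrow>
     (\<exists>p u v. norm u = 1 \<and> norm v = 1 \<and> u \<bullet> v = 0 \<and>
        T = {p + s *\<^sub>R u + t *\<^sub>R v | s t. 0 \<le> s \<and> s \<le> l \<and> 0 \<le> t \<and> t \<le> w})"

abbreviation is_square :: "real \<Rightarrow> point set \<Rightarrow> bool" where
  "is_square l \<equiv> is_rectangle l l"

definition covered_by_unit_squares :: "point set \<Rightarrow> nat \<Rightarrow> bool" where
  "covered_by_unit_squares A N \<longleftrightarrow>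
     (\<exists>Q :: nat \<Rightarrow> point set. (\<forall>i<N. is_square 1 (Q i)) \<and> A \<subseteq> (\<Union>i<N. Q i))"

text \<open>The infimum is over a nonempty set whenever \<open>A\<close> is bounded, see
  \<open>bounded_imp_covered_by_unit_squares\<close> below; the value is meaningless for unbounded \<open>A\<close>.\<close>

definition covering_waste :: "point set \<Rightarrow> real" where
  "covering_waste A = Inf {real N | N. covered_by_unit_squares A N} - measure lebesgue A"

text \<open>The right trapezoid with lower left corner \<open>p\<close>, vertical left side, horizontal top edge of
  length \<open>a\<close>, height \<open>h\<close>, and right-hand side making the angle \<open>\<theta>\<close> with the vertical. At height
  \<open>t\<close> above the bottom edge its horizontal width is \<open>a + (h - t) * tan \<theta>\<close>, so the bottom edge
  (\<open>t = 0\<close>) has length \<open>a + h * tan \<theta>\<close>.\<close>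

definition right_trapezoid :: "point \<Rightarrow> real \<Rightarrow> real \<Rightarrow> real \<Rightarrow> point set" where
  "right_trapezoid p a h \<theta> =
     {p + (s, t) | s t. 0 \<le> t \<and> t \<le> h \<and> 0 \<le> s \<and> s \<le> a + (h - t) * tan \<theta>}"

lemma ball_subset_unit_square:
  fixes z :: point
  shows "\<exists>Q. is_square 1 Q \<and> ball z (1/2) \<subseteq> Q"
proof -
  obtain a b where z: "z = (a, b)" by (cases z)
  define Q where "Q = {(a - 1/2, b - 1/2) + s *\<^sub>R (1, 0) + t *\<^sub>R (0, 1) | s t :: real.
    0 \<le> s \<and> s \<le> 1 \<and> 0 \<le> t \<and> t \<le> 1}"
  have "is_square 1 Q"
    unfolding is_rectangle_def Q_def
    by (rule exI[of _ "(a - 1/2, b - 1/2)"], rule exI[of _ "(1, 0)"], rule exI[of _ "(0, 1)"])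
       (simp add: norm_Pair)
  moreover have "ball z (1/2) \<subseteq> Q"
  proof
    fix y assume "y \<in> ball z (1/2)"
    then have d: "dist z y < 1/2" by simp
    obtain c e where y: "y = (c, e)" by (cases y)
    have "dist a c < 1/2" "dist b e < 1/2"
      using d dist_fst_le[of z y] dist_snd_le[of z y] by (simp_all add: z y)
    then have ac: "0 \<le> c - a + 1/2" "c - a + 1/2 \<le> 1"
      and be: "0 \<le> e - b + 1/2" "e - b + 1/2 \<le> 1"
      unfolding dist_real_def by linarith+
    have "y = (a - 1/2, b - 1/2) + (c - a + 1/2) *\<^sub>R (1, 0) + (e - b + 1/2) *\<^sub>R (0, 1)"
      by (simp add: y)
    then show "y \<in> Q"
      unfolding Q_def using ac be by fast
  qed
  ultimately show ?thesis by blast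
qed

lemma bounded_imp_covered_by_unit_squares:
  assumes "bounded A"
  shows "\<exists>N. covered_by_unit_squares A N"
proof -
  have "compact (closure A)"
    using assms by (simp add: compact_eq_bounded_closed bounded_closure)
  then have "\<forall>e>0. \<exists>k. finite k \<and> closure A \<subseteq> (\<Union>x\<in>k. ball x e)"
    unfolding compact_eq_totally_bounded by (rule conjunct2)
  then have "\<exists>k. finite k \<and> closure A \<subseteq> (\<Union>x\<in>k. ball x (1/2))"
    by (rule allE[of _ "1/2"]) simp
  then obtain k where k: "finite k" "closure A \<subseteq> (\<Union>x\<in>k. ball x (1/2))"
    by blast
  obtain q where q: "\<And>z :: point. is_square 1 (q z) \<and> ball z (1/2) \<subseteq> q z"
    using ball_subset_unit_square by metis
  obtain g where g: "bij_betw g {..<card k} k"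
    using ex_bij_betw_nat_finite[OF k(1)] by (auto simp: atLeast0LessThan)
  have "A \<subseteq> (\<Union>x\<in>k. q x)"
  proof
    fix y assume "y \<in> A"
    then have "y \<in> (\<Union>x\<in>k. ball x (1/2))"
      using k(2) closure_subset by (meson subsetD)
    then obtain z where "z \<in> k" "y \<in> ball z (1/2)"
      by (elim UN_E)
    then show "y \<in> (\<Union>x\<in>k. q x)"
      using q[of z] by (meson UN_I subsetD)
  qed
  moreover have "(\<Union>x\<in>g ` {..<card k}. q x) = (\<Union>i<card k. q (g i))"
    by (simp only: image_image)
  ultimately have "A \<subseteq> (\<Union>i<card k. q (g i))"
    by (simp only: bij_betw_imp_surj_on[OF g])
  then have "covered_by_unit_squares A (card k)"
    unfolding covered_by_unit_squares_def using q by (intro exI[of _ "\<lambda>i. q (g i)"]) simp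
  then show ?thesis ..
qed

end

theory Submission
  imports Defs "HOL-Real_Asymp.Real_Asymp"
begin

text \<open>Tilting a row of \<open>N\<close> unit squares by a small angle \<open>\<phi>\<close> shortens its
reach to \<open>N * cos \<phi> - sin \<phi>\<close>, so parallel tilted rows can cover a strip of
non-integer width \<open>g\<close>, where \<open>N - 1 \<le> g < N\<close>, with nothing wasted
along the strip but a sawtooth of height \<open>sin \<phi>\<close>, which is of order \<open>1 /
sqrt g\<close>. This idea is used at two different scales.

From a rectangle of length \<open>x\<close> and width at most of order \<open>x\<close> an integer
rectangle is cut off at a corner (\<open>coverable_rectangle_split\<close>). The two remaining
strips have width about \<open>g = x powr (3/4)\<close> and are covered by tilted rods
(\<open>coverable_tilted_strip\<close>) with a sawtooth waste of order \<open>x / sqrt g = x powr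
(5/8)\<close>. At their ends there remain right trapezoids of height \<open>g\<close> and width of
order \<open>sqrt g\<close> whose slanted side has slope of order \<open>1 / sqrt g\<close>. If
these can be covered with waste of order \<open>g powr (5/6)\<close>, the ends cost \<open>x powr
(5/8)\<close> as well.

Such a trapezoid, of height \<open>X\<close>, is cut into about \<open>2 * sqrt X\<close> layers
of height about \<open>sqrt X / 2\<close> (\<open>coverable_layered_trapezoid\<close>). A layer
consists of a rectangle with sides of order \<open>sqrt X\<close> and a thin trapezoid of width
about \<open>X powr (1/3)\<close>, whose width changes by less than one over the layer. The thin
trapezoid is covered with waste of order \<open>X powr (1/3)\<close> by rows that are partly
tilted and partly upright (\<open>coverable_thin_trapezoid\<close>).

The rectangles in the layers need the result for rectangles, though at a much smaller scale and
with a weaker exponent: any exponent below \<open>2/3\<close> makes their contribution negligible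
against \<open>X powr (5/6)\<close>. Starting with the trivial exponent \<open>1\<close>, the
passage from rectangles to trapezoids and back improves the exponent to \<open>3/4\<close> and
then to \<open>21/32\<close>, which suffices (\<open>rectangle_bound_21_32\<close>). One further
round yields explicit constants.

All bounds are proved for numbers of squares. Lower bounds for the areas then turn them into
bounds for the waste.\<close>

section \<open>Covering counts under unions and isometries\<close>

text \<open>The bound is a real number so that covering bounds can be added up and compared with areas without
rounding.\<close>

definition coverable :: "point set \<Rightarrow> real \<Rightarrow> bool" where
  "coverable A r \<longleftrightarrow> (\<exists>N. covered_by_unit_squares A N \<and> real N \<le> r)"

lemma coverable_mono:
  assumes "coverable B r" "A \<subseteq> B" "r \<le> s"
  shows "coverable A s"
  using assms unfolding coverable_def covered_by_unit_squares_def
  by (meson order_trans subset_trans)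

lemma coverable_empty: "0 \<le> r \<Longrightarrow> coverable {} r"
  unfolding coverable_def covered_by_unit_squares_def by (rule exI[of _ 0]) simp

lemma coverable_Un:
  assumes "coverable A r" "coverable B s"
  shows "coverable (A \<union> B) (r + s)"
proof -
  obtain N Q where Q: "\<forall>i<N. is_square 1 (Q i)" "A \<subseteq> (\<Union>i<N. Q i)" "real N \<le> r"
    using assms(1) unfolding coverable_def covered_by_unit_squares_def by blast
  obtain M R where R: "\<forall>i<M. is_square 1 (R i)" "B \<subseteq> (\<Union>i<M. R i)" "real M \<le> s"
    using assms(2) unfolding coverable_def covered_by_unit_squares_def by blast
  define P where "P i = (if i < N then Q i else R (i - N))" for i
  have 1: "\<forall>i<N + M. is_square 1 (P i)"
    using Q(1) R(1) by (auto simp: P_def)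
  have "A \<union> B \<subseteq> (\<Union>i<N + M. P i)"
  proof
    fix z assume "z \<in> A \<union> B"
    then consider i where "i < N" "z \<in> Q i" | i where "i < M" "z \<in> R i"
      using Q(2) R(2) by blast
    then show "z \<in> (\<Union>i<N + M. P i)"
    proof cases
      case (1 i)
      then show ?thesis by (intro UN_I[of i]) (auto simp: P_def)
    next
      case (2 i)
      then show ?thesis by (intro UN_I[of "N + i"]) (auto simp: P_def)
    qed
  qed
  then show ?thesis
    using 1 Q(3) R(3) unfolding coverable_def covered_by_unit_squares_def
    by (intro exI[of _ "N + M"] conjI exI[of _ P]) auto
qed

lemma coverable_UN:
  assumes "finite I" "\<And>i. i \<in> I \<Longrightarrow> coverable (A i) (r i)"
  shows "coverable (\<Union>i\<in>I. A i) (\<Sum>i\<in>I. r i)"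
  using assms
proof (induction I rule: finite_induct)
  case empty
  then show ?case by (simp add: coverable_empty)
next
  case (insert i I)
  then show ?case using coverable_Un[of "A i" "r i"] by simp
qed

text \<open>Every isometry that is needed has the form \<open>place p u v\<close> for an orthonormal frame
\<open>u, v\<close>: it maps the coordinate axes to the lines through \<open>p\<close> in the
directions \<open>u\<close> and \<open>v\<close>. Rectangles are exactly the placed coordinate
boxes, so a placement carries coverings to coverings.\<close>

definition frame :: "point \<Rightarrow> point \<Rightarrow> bool" where
  "frame u v \<longleftrightarrow> norm u = 1 \<and> norm v = 1 \<and> u \<bullet> v = 0"

definition place :: "point \<Rightarrow> point \<Rightarrow> point \<Rightarrow> point \<Rightarrow> point" where
  "place p u v z = p + fst z *\<^sub>R u + snd z *\<^sub>R v"

lemma rectangle_iff_place: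
  "is_rectangle l w T \<longleftrightarrow> (\<exists>p u v. frame u v \<and> T = place p u v ` ({0..l} \<times> {0..w}))"
proof -
  have "{p + s *\<^sub>R u + t *\<^sub>R v | s t. 0 \<le> s \<and> s \<le> l \<and> 0 \<le> t \<and> t \<le> w}
      = place p u v ` ({0..l} \<times> {0..w})" for p u v
  proof (intro equalityI subsetI)
    fix z assume "z \<in> {p + s *\<^sub>R u + t *\<^sub>R v | s t. 0 \<le> s \<and> s \<le> l \<and> 0 \<le> t \<and> t \<le> w}"
    then obtain s t where "z = place p u v (s, t)" "(s, t) \<in> {0..l} \<times> {0..w}"
      by (auto simp: place_def)
    then show "z \<in> place p u v ` ({0..l} \<times> {0..w})" by (rule image_eqI)
  next
    fix z assume "z \<in> place p u v ` ({0..l} \<times> {0..w})"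
    then obtain s t where "z = p + s *\<^sub>R u + t *\<^sub>R v" "0 \<le> s \<and> s \<le> l \<and> 0 \<le> t \<and> t \<le> w"
      by (auto simp: place_def)
    then show "z \<in> {p + s *\<^sub>R u + t *\<^sub>R v | s t. 0 \<le> s \<and> s \<le> l \<and> 0 \<le> t \<and> t \<le> w}"
      by blast
  qed
  then show ?thesis
    unfolding is_rectangle_def frame_def by simp
qed

lemma inner_frame:
  assumes "frame u v"
  shows "(a *\<^sub>R u + b *\<^sub>R v) \<bullet> (c *\<^sub>R u + d *\<^sub>R v) = a * c + b * d"
proof -
  have "u \<bullet> u = 1" "v \<bullet> v = 1" "u \<bullet> v = 0" "v \<bullet> u = 0"
    using assms by (auto simp: frame_def norm_eq_1 inner_commute)
  then show ?thesis by (simp add: algebra_simps)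
qed

lemma frame_place:
  assumes "frame u v" "frame x y"
  shows "frame (place 0 u v x) (place 0 u v y)"
proof -
  have "place 0 u v x \<bullet> place 0 u v y = x \<bullet> y" for x y
    using inner_frame[OF assms(1)] by (cases x; cases y) (simp add: place_def)
  then show ?thesis
    using assms(2) by (simp add: frame_def norm_eq_sqrt_inner)
qed

lemma rectangle_place:
  assumes "frame u v" "is_rectangle l w T"
  shows "is_rectangle l w (place p u v ` T)"
proof -
  obtain q x y where *: "frame x y" "T = place q x y ` ({0..l} \<times> {0..w})"
    using assms(2) unfolding rectangle_iff_place by (elim exE conjE)
  have "place p u v (place q x y z)
      = place (place p u v q) (place 0 u v x) (place 0 u v y) z" for z
    by (simp add: place_def algebra_simps)
  then have "place p u v ` T
      = place (place p u v q) (place 0 u v x) (place 0 u v y) ` ({0..l} \<times> {0..w})"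
    by (simp add: * image_image)
  then show ?thesis
    unfolding rectangle_iff_place using frame_place[OF assms(1) *(1)] by (intro exI conjI)
qed

lemma coverable_place:
  assumes "frame u v" "coverable A r"
  shows "coverable (place p u v ` A) r"
proof -
  obtain N Q where Q: "\<forall>i<N. is_square 1 (Q i)" "A \<subseteq> (\<Union>i<N. Q i)" "real N \<le> r"
    using assms(2) unfolding coverable_def covered_by_unit_squares_def by blast
  have "\<forall>i<N. is_square 1 (place p u v ` Q i)"
    using Q(1) rectangle_place[OF assms(1)] by simp
  moreover have "place p u v ` A \<subseteq> (\<Union>i<N. place p u v ` Q i)"
    using image_mono[OF Q(2), of "place p u v"] by (simp only: image_UN)
  ultimately have "covered_by_unit_squares (place p u v ` A) N"
    unfolding covered_by_unit_squares_def by (intro exI conjI)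
  then show ?thesis
    using Q(3) unfolding coverable_def by blast
qed

text \<open>The point map \<open>g\<close> expresses points in the coordinates of the frame. With
\<open>g\<close> explicit, a covering problem is moved to convenient coordinates by a membership
check; the next four lemmas are the instances that occur.\<close>

lemma coverable_in_place:
  assumes "coverable A r" "frame u v" "\<And>z. z \<in> B \<Longrightarrow> g z \<in> A" "\<And>z. place p u v (g z) = z"
  shows "coverable B r"
proof (rule coverable_mono[OF coverable_place[OF assms(2,1), of p]])
  show "B \<subseteq> place p u v ` A"
    using assms(3,4) by (metis image_eqI subsetI)
qed simp

lemma coverable_translate:
  assumes "coverable A r" "\<And>s t. (s, t) \<in> B \<Longrightarrow> (s - a, t - b) \<in> A"
  shows "coverable B r"
proof (rule coverable_in_place[of A r "(1, 0)" "(0, 1)" B "\<lambda>z. (fst z - a, snd z - b)" "(a, b)"])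
  fix z assume "z \<in> B"
  then show "(fst z - a, snd z - b) \<in> A"
    by (intro assms(2)) (simp only: prod.collapse)
qed (simp_all add: assms(1) frame_def place_def norm_Pair)

lemma coverable_point_reflect:
  assumes "coverable A r" "\<And>s t. (s, t) \<in> B \<Longrightarrow> (a - s, b - t) \<in> A"
  shows "coverable B r"
proof (rule coverable_in_place[of A r "(- 1, 0)" "(0, - 1)" B "\<lambda>z. (a - fst z, b - snd z)" "(a, b)"])
  fix z assume "z \<in> B"
  then show "(a - fst z, b - snd z) \<in> A"
    by (intro assms(2)) (simp only: prod.collapse)
qed (simp_all add: assms(1) frame_def place_def norm_Pair)

lemma coverable_transpose:
  assumes "coverable A r" "\<And>s t. (s, t) \<in> B \<Longrightarrow> (t, s) \<in> A"
  shows "coverable B r"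
proof (rule coverable_in_place[of A r "(0, 1)" "(1, 0)" B "\<lambda>z. (snd z, fst z)" "(0, 0)"])
  fix z assume "z \<in> B"
  then show "(snd z, fst z) \<in> A"
    by (intro assms(2)) (simp only: prod.collapse)
qed (simp_all add: assms(1) frame_def place_def norm_Pair)

lemma coverable_rotate:
  assumes "coverable A r"
    "\<And>s t. (s, t) \<in> B \<Longrightarrow> (s * cos \<phi> - t * sin \<phi>, s * sin \<phi> + t * cos \<phi>) \<in> A"
  shows "coverable B r"
proof (rule coverable_in_place[of A r "(cos \<phi>, - sin \<phi>)" "(sin \<phi>, cos \<phi>)" B
      "\<lambda>z. (fst z * cos \<phi> - snd z * sin \<phi>, fst z * sin \<phi> + snd z * cos \<phi>)" 0])
  fix z :: point
  obtain s t where st: "z = (s, t)" by (cases z)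
  have "(s * cos \<phi> - t * sin \<phi>) * cos \<phi> + (s * sin \<phi> + t * cos \<phi>) * sin \<phi>
      = s * ((sin \<phi>)\<^sup>2 + (cos \<phi>)\<^sup>2)"
    "(s * sin \<phi> + t * cos \<phi>) * cos \<phi> - (s * cos \<phi> - t * sin \<phi>) * sin \<phi>
      = t * ((sin \<phi>)\<^sup>2 + (cos \<phi>)\<^sup>2)"
    by (simp_all only: power2_eq_square algebra_simps)
  then show "place 0 (cos \<phi>, - sin \<phi>) (sin \<phi>, cos \<phi>)
      (fst z * cos \<phi> - snd z * sin \<phi>, fst z * sin \<phi> + snd z * cos \<phi>) = z"
    by (simp add: place_def st)
next
  fix z assume "z \<in> B"
  then show "(fst z * cos \<phi> - snd z * sin \<phi>, fst z * sin \<phi> + snd z * cos \<phi>) \<in> A"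
    by (intro assms(2)) (simp only: prod.collapse)
qed (simp_all add: assms(1) frame_def norm_Pair)

lemma coverable_unit_box: "coverable ({a..a + 1} \<times> {b..b + 1}) 1"
proof -
  have "place (a, b) (1, 0) (0, 1) ` ({0..1} \<times> {0..1}) = {a..a + 1} \<times> {b..b + 1}" (is "?f ` _ = _")
  proof (intro equalityI subsetI)
    fix z assume "z \<in> {a..a + 1} \<times> {b..b + 1}"
    then obtain x y where xy: "z = (x, y)" "x \<in> {a..a + 1}" "y \<in> {b..b + 1}" by blast
    show "z \<in> ?f ` ({0..1} \<times> {0..1})"
      by (rule image_eqI[of _ _ "(x - a, y - b)"]) (use xy in \<open>simp_all add: place_def\<close>)
  qed (auto simp: place_def)
  moreover have "frame (1, 0) (0, 1)"
    by (simp add: frame_def norm_Pair)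
  ultimately have "is_square 1 ({a..a + 1} \<times> {b..b + 1})"
    unfolding rectangle_iff_place by (intro exI conjI) (assumption, rule sym)
  then show ?thesis
    unfolding coverable_def covered_by_unit_squares_def
    by (intro exI[of _ 1] conjI exI[of _ "\<lambda>_. {a..a + 1} \<times> {b..b + 1}"]) auto
qed

lemma interval_subset_unit_steps:
  fixes a b :: real
  assumes "b \<le> a + real m" "m \<ge> 1"
  shows "{a..b} \<subseteq> (\<Union>i<m. {a + real i..a + real i + 1})"
proof
  fix x assume x: "x \<in> {a..b}"
  \<comment> \<open>The right end point \<open>a + m\<close> lies in the last step, not in a step of its
    own.\<close>
  show "x \<in> (\<Union>i<m. {a + real i..a + real i + 1})"
  proof (cases "x < a + real m")
    case True
    then have "nat \<lfloor>x - a\<rfloor> < m" using x by (simp add: nat_less_iff floor_less_iff)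
    moreover have "x \<in> {a + real (nat \<lfloor>x - a\<rfloor>)..a + real (nat \<lfloor>x - a\<rfloor>) + 1}"
      using x by (simp add: of_nat_nat) linarith
    ultimately show ?thesis by blast
  next
    case False
    then have "x \<in> {a + real (m - 1)..a + real (m - 1) + 1}"
      using x assms by (simp add: of_nat_diff)
    then show ?thesis using assms(2) by (intro UN_I[of "m - 1"]) auto
  qed
qed

text \<open>The counts \<open>m\<close> and \<open>k\<close> must be positive: a degenerate box is a nonempty
set of zero width and still needs a square.\<close>

lemma coverable_box:
  fixes a b c d :: real and m k :: nat
  assumes "b \<le> a + real m" "d \<le> c + real k" "1 \<le> m" "1 \<le> k"
  shows "coverable ({a..b} \<times> {c..d}) (real m * real k)"
proof -
  have "coverable (\<Union>i<m. \<Union>j<k. {a + real i..a + real i + 1} \<times> {c + real j..c + real j + 1})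
      (\<Sum>i<m. \<Sum>j<k. 1)"
    by (intro coverable_UN coverable_unit_box) auto
  moreover have "{a..b} \<times> {c..d}
      \<subseteq> (\<Union>i<m. \<Union>j<k. {a + real i..a + real i + 1} \<times> {c + real j..c + real j + 1})"
    using interval_subset_unit_steps[OF assms(1,3)] interval_subset_unit_steps[OF assms(2,4)]
    by blast
  ultimately show ?thesis by (rule coverable_mono) simp
qed

lemma coverable_unit_column:
  fixes a c d :: real
  assumes "c \<le> d"
  shows "coverable ({a..a + 1} \<times> {c..d}) (d - c + 1)"
proof -
  have "d \<le> c + real (nat \<lfloor>d - c\<rfloor> + 1)" "real (nat \<lfloor>d - c\<rfloor> + 1) \<le> d - c + 1"
    using assms by (simp_all add: of_nat_nat) linarith+
  then show ?thesis
    by (intro coverable_mono[OF coverable_box[of "a + 1" a 1 d c "nat \<lfloor>d - c\<rfloor> + 1"]]) auto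
qed

lemma coverable_rectangle_trivial:
  assumes "0 \<le> l" "0 \<le> w"
  shows "coverable ({0..l} \<times> {0..w}) ((l + 1) * (w + 1))"
proof -
  have "l \<le> 0 + real (nat \<lfloor>l\<rfloor> + 1)" "real (nat \<lfloor>l\<rfloor> + 1) \<le> l + 1"
    "w \<le> 0 + real (nat \<lfloor>w\<rfloor> + 1)" "real (nat \<lfloor>w\<rfloor> + 1) \<le> w + 1"
    using assms by (simp_all add: of_nat_nat) linarith+
  then show ?thesis
    using assms
    by (intro coverable_mono[OF coverable_box[of l 0 "nat \<lfloor>l\<rfloor> + 1" w 0 "nat \<lfloor>w\<rfloor> + 1"]] mult_mono) auto
qed

lemma coverable_placed_rectangle:
  assumes "coverable ({0..l} \<times> {0..w}) r" "is_rectangle l w T"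
  shows "coverable T r"
  using assms unfolding rectangle_iff_place by (elim exE conjE) (simp add: coverable_place)

lemma covering_waste_le:
  assumes "coverable A r"
  shows "covering_waste A \<le> r - measure lebesgue A"
proof -
  obtain N where N: "covered_by_unit_squares A N" "real N \<le> r"
    using assms unfolding coverable_def by blast
  have "bdd_below {real N | N. covered_by_unit_squares A N}"
    by (rule bdd_belowI[of _ 0]) auto
  then have "Inf {real N | N. covered_by_unit_squares A N} \<le> real N"
    using N(1) by (intro cInf_lower) auto
  then show ?thesis using N(2) by (simp add: covering_waste_def)
qed

section \<open>Areas of rectangles and right trapezoids\<close>

text \<open>The behaviour of Lebesgue measure under linear maps is known for the vector type
\<open>real^2\<close>. It is transported to pairs along the coordinate isomorphism, which
preserves boxes and therefore the measure.\<close>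

definition vec_pt :: "real^2 \<Rightarrow> point" where "vec_pt z = (z $ 1, z $ 2)"
definition pt_vec :: "point \<Rightarrow> real^2" where "pt_vec w = vector [fst w, snd w]"

lemma vec_pt_inverse [simp]: "pt_vec (vec_pt z) = z" "vec_pt (pt_vec w) = w"
  by (simp_all add: vec_pt_def pt_vec_def vec_eq_iff forall_2)

lemma continuous_vec_pt [continuous_intros]: "continuous_on A vec_pt"
  unfolding vec_pt_def by (intro continuous_intros)

lemma linear_vec_pt: "linear vec_pt" and linear_pt_vec: "linear pt_vec"
  by (auto intro!: linearI simp: vec_pt_def pt_vec_def vec_eq_iff forall_2)

lemma norm_vec_pt: "norm (vec_pt z) = norm z"
  by (simp add: vec_pt_def norm_Pair norm_vec_def L2_set_def sum_2)

lemma norm_pt_vec: "norm (pt_vec w) = norm w"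
  using norm_vec_pt[of "pt_vec w"] by simp

lemma lborel_vec_pt: "lborel = distr lborel borel vec_pt"
proof (rule lborel_eqI)
  have [measurable]: "vec_pt \<in> borel \<rightarrow>\<^sub>M borel"
    by (rule borel_measurable_continuous_onI) (rule continuous_vec_pt)
  fix l u :: point assume le: "\<And>b. b \<in> Basis \<Longrightarrow> l \<bullet> b \<le> u \<bullet> b"
  have B: "(Basis :: (real^2) set) = {axis 1 1, axis 2 1}"
    by (auto simp: Basis_vec_def UNIV_2)
  have "vec_pt -` box l u = box (pt_vec l) (pt_vec u)"
    by (auto simp: vec_pt_def pt_vec_def mem_box B inner_axis Basis_prod_def inner_prod_def)
  moreover have "fst l \<le> fst u" "snd l \<le> snd u"
    using le[of "(1, 0)"] le[of "(0, 1)"] by (auto simp: Basis_prod_def inner_prod_def)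
  ultimately show "emeasure (distr lborel borel vec_pt) (box l u) = (\<Prod>b\<in>Basis. (u - l) \<bullet> b)"
    by (auto simp: emeasure_distr emeasure_lborel_box_eq B inner_axis pt_vec_def axis_eq_axis
        Basis_prod_def inner_prod_def)
qed simp

lemma vec_pt_vimage: "vec_pt -` S = pt_vec ` S"
proof (intro equalityI subsetI)
  fix z assume "z \<in> vec_pt -` S"
  then show "z \<in> pt_vec ` S"
    by (intro image_eqI[of z pt_vec "vec_pt z"]) simp_all
qed auto

lemma compact_vec_pt_vimage: "compact S \<Longrightarrow> compact (vec_pt -` S)"
  unfolding vec_pt_vimage using linear_pt_vec
  by (simp add: compact_continuous_image linear_continuous_on linear_conv_bounded_linear)

lemma measure_vec_pt:
  assumes "compact S"
  shows "measure lebesgue S = measure lebesgue (vec_pt -` S)"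
proof -
  have [measurable]: "vec_pt \<in> borel \<rightarrow>\<^sub>M borel"
    by (rule borel_measurable_continuous_onI) (rule continuous_vec_pt)
  have "measure lborel S = measure (distr lborel borel vec_pt) S"
    by (simp only: lborel_vec_pt[symmetric])
  also have "\<dots> = measure lborel (vec_pt -` S)"
    using borel_compact[OF assms] by (subst measure_distr) auto
  finally show ?thesis
    using borel_compact[OF assms] borel_compact[OF compact_vec_pt_vimage[OF assms]] by simp
qed

lemma measure_place:
  assumes "frame u v" "compact S"
  shows "measure lebesgue (place p u v ` S) = measure lebesgue S"
proof -
  define f where "f = place 0 u v"
  define h where "h = pt_vec \<circ> f \<circ> vec_pt"
  have lf: "linear f"
    by (auto intro!: linearI simp: f_def place_def algebra_simps)
  have nf: "norm (f z) = norm z" for z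
    using inner_frame[OF assms(1)] by (cases z) (simp add: f_def place_def norm_eq_sqrt_inner)
  have h: "orthogonal_transformation h"
    unfolding orthogonal_transformation h_def
    using lf linear_vec_pt linear_pt_vec by (auto intro!: linear_compose simp: norm_pt_vec nf norm_vec_pt)
  have cf: "compact (f ` S)"
    using assms(2) lf by (simp add: compact_continuous_image linear_continuous_on linear_conv_bounded_linear)
  have "vec_pt -` (f ` S) = h ` (vec_pt -` S)"
    by (simp add: vec_pt_vimage h_def image_comp comp_def)
  then have "measure lebesgue (f ` S) = measure lebesgue (h ` (vec_pt -` S))"
    using measure_vec_pt[OF cf] by simp
  also have "\<dots> = measure lebesgue (vec_pt -` S)"
    using h compact_vec_pt_vimage[OF assms(2)] by (intro measure_orthogonal_image lmeasurable_compact)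
  also have "\<dots> = measure lebesgue S"
    using measure_vec_pt[OF assms(2)] by simp
  finally have "measure lebesgue (f ` S) = measure lebesgue S" .
  moreover have "place p u v ` S = (+) p ` f ` S"
    by (simp add: image_image f_def place_def add.assoc)
  ultimately show ?thesis by (simp add: measure_translation)
qed

lemma measure_box:
  assumes "0 \<le> l" "0 \<le> w"
  shows "measure lebesgue ({0..l} \<times> {0..w}) = l * w"
proof -
  have "{0..l} \<times> {0..w} = cbox (0, 0) (l, w)"
    by (simp add: cbox_Pair_eq)
  then show ?thesis
    using assms by (simp add: content_Pair)
qed

lemma measure_rectangle:
  assumes "is_rectangle l w T" "0 \<le> l" "0 \<le> w"
  shows "measure lebesgue T = l * w"
proof -
  obtain p u v where "frame u v" "T = place p u v ` ({0..l} \<times> {0..w})"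
    using assms(1) unfolding rectangle_iff_place by (elim exE conjE)
  then show ?thesis
    using measure_place[of u v "{0..l} \<times> {0..w}" p] measure_box[OF assms(2,3)]
    by (simp add: compact_Times)
qed

text \<open>The second coordinate measures depth below the top edge. With this orientation the side has the
equation \<open>s = a + \<kappa> * t\<close>, and cutting off the part above a given depth leaves
a trapezoid of the same slope \<open>\<kappa>\<close>.\<close>

definition trapezoid :: "real \<Rightarrow> real \<Rightarrow> real \<Rightarrow> point set" where
  "trapezoid a h \<kappa> = {(s, t). 0 \<le> t \<and> t \<le> h \<and> 0 \<le> s \<and> s \<le> a + \<kappa> * t}"

lemma right_trapezoid_eq_place:
  "right_trapezoid p a h \<theta> = place (p + (0, h)) (1, 0) (0, - 1) ` trapezoid a h (tan \<theta>)"
proof (intro equalityI subsetI)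
  fix z assume "z \<in> right_trapezoid p a h \<theta>"
  then obtain s t where "z = p + (s, t)" "0 \<le> t" "t \<le> h" "0 \<le> s" "s \<le> a + (h - t) * tan \<theta>"
    unfolding right_trapezoid_def by auto
  then show "z \<in> place (p + (0, h)) (1, 0) (0, - 1) ` trapezoid a h (tan \<theta>)"
    by (intro image_eqI[of _ _ "(s, h - t)"]) (auto simp: place_def trapezoid_def mult.commute)
next
  fix z assume "z \<in> place (p + (0, h)) (1, 0) (0, - 1) ` trapezoid a h (tan \<theta>)"
  then obtain s t where z: "z = place (p + (0, h)) (1, 0) (0, - 1) (s, t)"
    "0 \<le> t" "t \<le> h" "0 \<le> s" "s \<le> a + tan \<theta> * t"
    unfolding trapezoid_def by auto
  then have "z = p + (s, h - t)" "s \<le> a + (h - (h - t)) * tan \<theta>"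
    by (auto simp: place_def mult.commute prod_eq_iff)
  then show "z \<in> right_trapezoid p a h \<theta>"
    unfolding right_trapezoid_def using z by (intro CollectI exI[of _ s] exI[of _ "h - t"]) auto
qed

lemma compact_trapezoid:
  assumes "0 \<le> \<kappa>"
  shows "compact (trapezoid a h \<kappa>)"
proof (rule compact_eq_bounded_closed[THEN iffD2], intro conjI)
  have "a + \<kappa> * t \<le> a + \<kappa> * h" if "t \<le> h" for t
    using assms that by (intro add_left_mono mult_left_mono)
  then have "trapezoid a h \<kappa> \<subseteq> {0..a + \<kappa> * h} \<times> {0..h}"
    unfolding trapezoid_def by fastforce
  then show "bounded (trapezoid a h \<kappa>)"
    by (rule bounded_subset[rotated]) (simp add: bounded_Times)
  have "trapezoid a h \<kappa>
      = {z. 0 \<le> snd z} \<inter> {z. snd z \<le> h} \<inter> {z. 0 \<le> fst z} \<inter> {z. fst z \<le> a + \<kappa> * snd z}"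
    by (auto simp: trapezoid_def)
  then show "closed (trapezoid a h \<kappa>)"
    by (auto intro!: closed_Int closed_Collect_le continuous_intros)
qed

text \<open>A trapezoid and its image under a half turn together cover a rectangle of width \<open>2 * a +
\<kappa> * h\<close>, so each of the two has at least half of its area.\<close>

lemma measure_right_trapezoid_ge:
  assumes "0 \<le> a" "0 \<le> h" "0 \<le> tan \<theta>"
  shows "a * h + tan \<theta> * h\<^sup>2 / 2 \<le> measure lebesgue (right_trapezoid p a h \<theta>)"
proof -
  define \<kappa> where "\<kappa> = tan \<theta>"
  define T where "T = trapezoid a h \<kappa>"
  define w where "w = 2 * a + \<kappa> * h"
  define R where "R = place (w, h) (- 1, 0) (0, - 1) ` T"
  have \<kappa>: "0 \<le> \<kappa>" using assms(3) by (simp add: \<kappa>_def)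
  have T: "compact T" unfolding T_def using \<kappa> by (rule compact_trapezoid)
  have fr: "frame (- 1, 0) (0, - 1)" "frame (1, 0) (0, - 1)"
    by (simp_all add: frame_def norm_Pair)
  have R: "R \<in> lmeasurable"
  proof -
    have "continuous_on T (place (w, h) (- 1, 0) (0, - 1))"
      unfolding place_def by (intro continuous_intros)
    then show ?thesis
      unfolding R_def using T by (intro lmeasurable_compact compact_continuous_image)
  qed
  have "{0..w} \<times> {0..h} \<subseteq> T \<union> R"
  proof (intro subsetI)
    fix z assume "z \<in> {0..w} \<times> {0..h}"
    then obtain s t where z: "z = (s, t)" "0 \<le> s" "s \<le> w" "0 \<le> t" "t \<le> h" by auto
    show "z \<in> T \<union> R"
    proof (cases "s \<le> a + \<kappa> * t")
      case True
      then show ?thesis using z by (simp add: T_def trapezoid_def)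
    next
      case False
      then have "(w - s, h - t) \<in> T"
        using z by (auto simp: T_def trapezoid_def w_def algebra_simps)
      then have "z \<in> R"
        unfolding R_def by (rule image_eqI[rotated]) (simp add: place_def z)
      then show ?thesis by simp
    qed
  qed
  moreover have "{0..w} \<times> {0..h} \<in> lmeasurable"
    by (intro lmeasurable_compact compact_Times) auto
  ultimately have "measure lebesgue ({0..w} \<times> {0..h}) \<le> measure lebesgue (T \<union> R)"
    using T R by (intro measure_mono_fmeasurable) (auto intro: lmeasurable_compact)
  also have "\<dots> \<le> measure lebesgue T + measure lebesgue R"
    using T R by (intro measure_Un_le) (auto dest: lmeasurable_compact)
  also have "measure lebesgue R = measure lebesgue T"
    unfolding R_def by (rule measure_place[OF fr(1) T])
  also have "measure lebesgue ({0..w} \<times> {0..h}) = w * h"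
    using assms \<kappa> by (intro measure_box) (auto simp: w_def)
  finally have "w * h / 2 \<le> measure lebesgue T" by simp
  moreover have "measure lebesgue (right_trapezoid p a h \<theta>) = measure lebesgue T"
    unfolding right_trapezoid_eq_place T_def \<kappa>_def[symmetric]
    by (rule measure_place[OF fr(2)]) (rule compact_trapezoid[OF \<kappa>])
  ultimately show ?thesis
    by (simp add: w_def \<kappa>_def power2_eq_square field_simps)
qed

lemma coverable_right_trapezoid:
  assumes "coverable (trapezoid a h (tan \<theta>)) r"
  shows "coverable (right_trapezoid p a h \<theta>) r"
  unfolding right_trapezoid_eq_place
  by (rule coverable_place[OF _ assms]) (simp add: frame_def norm_Pair)

section \<open>Thin trapezoids\<close>

text \<open>The right-hand side is the first term plus the area of the triangle under the line \<open>h - u *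
d\<close>.\<close>

lemma sum_truncated_progression_le:
  fixes h d :: real
  assumes "0 < d" "0 \<le> h"
  shows "(\<Sum>i<n. max 0 (h - real i * d)) \<le> h + h\<^sup>2 / (2 * d)"
  using assms(2)
proof (induction n arbitrary: h)
  case 0
  then show ?case using assms(1) by simp
next
  case (Suc n)
  have *: "(\<Sum>i<Suc n. max 0 (h - real i * d)) = h + (\<Sum>i<n. max 0 (h - d - real i * d))"
  proof -
    have "h - real (Suc i) * d = h - d - real i * d" for i
      by (simp add: algebra_simps)
    then show ?thesis
      by (simp only: sum.lessThan_Suc_shift) (use Suc.prems in simp)
  qed
  show ?case
  proof (cases "d \<le> h")
    case True
    have "h + (h - d + (h - d)\<^sup>2 / (2 * d)) = h + h\<^sup>2 / (2 * d) - d / 2"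
      using assms(1) by (simp add: field_simps power2_eq_square)
    then show ?thesis using Suc.IH[of "h - d"] True * assms(1) by simp
  next
    case False
    have "h - d - real i * d \<le> 0" for i
    proof -
      have "0 \<le> real i * d" using assms(1) by simp
      then show ?thesis using False by linarith
    qed
    then have "(\<Sum>i<n. max 0 (h - d - real i * d)) = 0"
      by (intro sum.neutral ballI max_absorb1)
    then show ?thesis using * assms(1) by simp
  qed
qed

text \<open>This is the heart of the argument. The width of the trapezoid grows from \<open>a\<close> to less
than \<open>n = a + 1\<close>, and rows of \<open>n\<close> squares parallel to the axes would
waste up to one unit of width at every height, which is far too much. Tilting a row of
\<open>m\<close> squares by \<open>\<phi>\<close> shortens its horizontal reach by \<open>m * (1 -
cos \<phi>) + sin \<phi>\<close>. The angle is chosen so that a fully tilted row of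
\<open>n\<close> squares reaches exactly \<open>a\<close>, and it is kept fixed: changing the
angle from row to row would leave expensive wedges between rows. Instead, the number of tilted
squares decreases with the depth. A row has \<open>n - p\<close> tilted squares at its right end,
and the remaining \<open>p\<close> units on the left are left to columns parallel to the axes.
Since each tilted square saves \<open>1 - cos \<phi>\<close> in width, any width between
\<open>a\<close> and \<open>n - sin \<phi>\<close> is met up to \<open>1 - cos \<phi>\<close>,
about \<open>1 / n\<close>.

For the count, fix a unit column \<open>{i..i + 1}\<close>. It meets the tilted region above some
depth and the upright region below it. Counting squares by columns costs a bounded rounding error
per column, hence \<open>3 * n\<close> in total, and this includes the triangles at the top and at
the bottom where the tilted rows stop. The sawtooth between the tilted rows and the vertical lines
accounts for \<open>h * sin \<phi>\<close>.\<close>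

lemma coverable_thin_trapezoid:
  fixes a :: nat and h \<kappa> \<phi> :: real
  defines "n \<equiv> real a + 1"
  assumes \<phi>: "0 < \<phi>" "\<phi> < pi / 2" and tilt: "n * (1 - cos \<phi>) + sin \<phi> = 1"
    and \<kappa>: "0 < \<kappa>" "\<kappa> \<le> tan \<phi>" "h * \<kappa> \<le> 1 - sin \<phi>" and h: "real a * tan \<phi> \<le> h"
  shows "coverable (trapezoid (real a) h \<kappa>)
    (real a * h + \<kappa> * h\<^sup>2 / 2 + 3 * n + 2 * n * tan \<phi> + h * sin \<phi> + h * (1 - cos \<phi>))"
proof -
  define C S t where "C = cos \<phi>" and "S = sin \<phi>" and "t = tan \<phi>"
  have C0: "0 < C" and S0: "0 < S"
    using \<phi> by (auto simp: C_def S_def cos_gt_zero sin_gt_zero)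
  have CS: "C * C + S * S = 1"
    using sin_cos_squared_add2[of \<phi>] by (simp add: C_def S_def power2_eq_square)
  have C1: "C < 1"
  proof (rule ccontr)
    assume "\<not> C < 1"
    then have "1 * 1 \<le> C * C" by (intro mult_mono) auto
    then show False using CS mult_pos_pos[OF S0 S0] by linarith
  qed
  have tS: "t * C = S" and t0: "0 < t"
    using C0 S0 by (auto simp: t_def C_def S_def tan_def)
  \<comment> \<open>In tilted coordinates a unit step down the slanted side advances by \<open>D\<close>
    rows. The width grows by \<open>c\<close>, the saving of one tilted square, over the
    depth \<open>d\<close>.\<close>
  define c d D where "c = 1 - C" and "d = c / \<kappa>" and "D = C + \<kappa> * S"
  have c0: "0 < c" and d0: "0 < d" and D0: "0 < D" and DC: "C \<le> D" and n0: "0 < n"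
    using C0 C1 S0 \<kappa>(1) by (auto simp: c_def d_def D_def n_def intro: add_pos_pos)
  have nC: "n * C = real a + S"
    using tilt by (simp add: n_def C_def S_def algebra_simps)
  have nc: "n * c = 1 - S"
    using tilt by (simp add: c_def C_def S_def)
  have \<kappa>CS: "\<kappa> * C \<le> S"
    using \<kappa>(2) C0 tS by (metis mult_le_cancel_right_pos t_def)
  have hC: "0 \<le> h * C - real a * S"
  proof -
    have "real a * t * C \<le> h * C" using h C0 by (simp add: t_def)
    then show ?thesis using tS by (simp add: mult.assoc)
  qed
  \<comment> \<open>Rows start at the line through the top right corner and stop at the line through the
    bottom left corner; the two triangles outside these lines are covered by upright
    columns.\<close>
  define J where "J = nat \<lceil>h * C - real a * S\<rceil>"
  have J: "h * C - real a * S \<le> real J" "real J \<le> h * C - real a * S + 1"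
  proof -
    have "real J = of_int \<lceil>h * C - real a * S\<rceil>"
      unfolding J_def using hC by (intro of_nat_nat) linarith
    then show "h * C - real a * S \<le> real J" "real J \<le> h * C - real a * S + 1"
      by linarith+
  qed
  \<comment> \<open>\<open>p j\<close> columns to the left of row \<open>j\<close> are left upright: the
    width has grown by \<open>\<kappa> * j / D\<close> where the row reaches the slanted
    side.\<close>
  define p where "p j = nat \<lceil>\<kappa> * real j / (c * D)\<rceil>" for j
  \<comment> \<open>The upright part of column \<open>i\<close> starts at depth \<open>e i\<close>, where
    the rows stop covering the column because they have become too short or because there
    are no more rows.\<close>
  define e where "e i = (real a - real i - 1) * t + min (h * C - real a * S) (D * (real i * d)) / C" for i
  \<comment> \<open>The position, along the row, of the point where the upper edge of row \<open>j\<close>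
    meets the slanted side.\<close>
  define X where "X j = (real a + \<kappa> * (real j / D)) * C - real j / D * S" for j
  define top where "top i = {real i..real i + 1} \<times> {0..(real a - real i) * t}" for i
  define low where "low i = {real i..real i + 1} \<times> {e i..h}" for i
  define row where "row j = (if p j < Suc a then {(s, \<tau>).
    (s * C - \<tau> * S, s * S + \<tau> * C) \<in> {X j - real (Suc a - p j)..X j} \<times>
      {real a * S + real j..real a * S + real j + 1}} else {})" for j

  have p_ge: "\<kappa> * real j / (c * D) \<le> real (p j)" for j
    unfolding p_def by (rule real_nat_ceiling_ge)
  have p_iff: "p j \<le> i \<longleftrightarrow> real j \<le> D * (real i * d)" for i j
  proof -
    have "p j \<le> i \<longleftrightarrow> \<kappa> * real j / (c * D) \<le> real i"
      by (simp add: p_def nat_le_iff ceiling_le_iff)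
    also have "\<dots> \<longleftrightarrow> real j \<le> D * (real i * d)"
      using c0 D0 \<kappa>(1) by (simp add: d_def field_simps)
    finally show ?thesis .
  qed
  have cover_point: "(s, \<tau>) \<in> (\<Union>i<Suc a. top i \<union> low i) \<union> (\<Union>j<J. row j)"
    if st: "(s, \<tau>) \<in> trapezoid (real a) h \<kappa>" for s \<tau>
  proof -
    have s: "0 \<le> s" "s \<le> real a + \<kappa> * \<tau>" and \<tau>: "0 \<le> \<tau>" "\<tau> \<le> h"
      using st by (auto simp: trapezoid_def)
    have "\<kappa> * \<tau> \<le> 1 - S"
    proof -
      have "\<kappa> * \<tau> \<le> \<kappa> * h" using \<kappa>(1) \<tau>(2) by (intro mult_left_mono) auto
      also have "\<dots> = h * \<kappa>" by (rule mult.commute)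
      also have "\<dots> \<le> 1 - S" using \<kappa>(3) by (simp only: S_def)
      finally show ?thesis .
    qed
    then have sn: "s < n" using s S0 unfolding n_def by linarith
    define i where "i = nat \<lfloor>s\<rfloor>"
    have i: "real i \<le> s" "s < real i + 1" "i < Suc a"
    proof -
      have "real i = of_int \<lfloor>s\<rfloor>"
        unfolding i_def using s(1) by (intro of_nat_nat) simp
      then show "real i \<le> s" "s < real i + 1" by linarith+
      then have "real i < real (Suc a)" using sn unfolding n_def by simp
      then show "i < Suc a" by (simp only: of_nat_less_iff)
    qed
    define y where "y = s * S + \<tau> * C"
    consider "y \<le> real a * S" | "real a * S < y" by linarith
    then show ?thesis
    proof cases
      case 1
      have "\<tau> * C \<le> (real a - real i) * t * C"
      proof -
        have "real i * S \<le> s * S" using i S0 by simp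
        then have "\<tau> * C \<le> (real a - real i) * S" using 1 by (simp add: y_def left_diff_distrib)
        then show ?thesis using tS by (simp add: mult.assoc)
      qed
      then have "\<tau> \<le> (real a - real i) * t" using C0 by simp
      then have "(s, \<tau>) \<in> top i" using i \<tau> by (simp add: top_def)
      then show ?thesis using i(3) by blast
    next
      case 2
      define j where "j = nat \<lfloor>y - real a * S\<rfloor>"
      have j: "real a * S + real j \<le> y" "y < real a * S + real j + 1"
      proof -
        have "real j = of_int \<lfloor>y - real a * S\<rfloor>"
          unfolding j_def using 2 by (intro of_nat_nat) simp
        then show "real a * S + real j \<le> y" "y < real a * S + real j + 1" by linarith+
      qed
      have iS: "s * S \<le> (real i + 1) * S" using i S0 by simp
      have lowI: ?thesis if "min (h * C - real a * S) (D * (real i * d)) \<le> \<tau> * C - (real a - real i - 1) * S"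
      proof -
        have "min (h * C - real a * S) (D * (real i * d)) / C \<le> (\<tau> * C - (real a - real i - 1) * (t * C)) / C"
          using that C0 tS by (simp add: divide_right_mono)
        also have "\<dots> = \<tau> - (real a - real i - 1) * t"
          using C0 by (simp add: field_simps)
        finally have "e i \<le> \<tau>" by (simp add: e_def)
        then have "(s, \<tau>) \<in> low i" using i \<tau> by (simp add: low_def)
        then show ?thesis using i(3) by blast
      qed
      consider "J \<le> j" | "j < J" "s < real (p j)" | "j < J" "real (p j) \<le> s" by linarith
      then show ?thesis
      proof cases
        case 1
        then have "real J \<le> real j" by simp
        then have "h * C - real a * S \<le> \<tau> * C - (real a - real i - 1) * S"
          using J(1) j(1) iS by (simp add: y_def algebra_simps)
        then show ?thesis by (intro lowI) linarith
      next
        case 2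
        then have "\<not> p j \<le> i" using i by linarith
        then have "D * (real i * d) < real j" using p_iff by simp
        then have "D * (real i * d) \<le> \<tau> * C - (real a - real i - 1) * S"
          using j(1) iS by (simp add: y_def algebra_simps)
        then show ?thesis by (intro lowI) linarith
      next
        \<comment> \<open>Row \<open>j\<close> is long enough on both sides.\<close>
        case 3
        have pn: "p j < Suc a" using 3(2) sn by (simp add: n_def)
        define \<rho> where "\<rho> = real j / D"
        have \<rho>D: "\<rho> * D = real j" using D0 by (simp add: \<rho>_def)
        have X_eq: "X j = (real a + \<kappa> * \<rho>) * C - \<rho> * S"
          by (simp only: X_def \<rho>_def)
        define x where "x = s * C - \<tau> * S"
        have "x \<le> X j"
        proof (cases "\<rho> \<le> \<tau>")
          case True
          have "s * C \<le> (real a + \<kappa> * \<tau>) * C" using s(2) C0 by simp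
          then have "x \<le> real a * C + \<tau> * (\<kappa> * C - S)"
            by (simp add: x_def algebra_simps)
          also have "\<dots> \<le> real a * C + \<rho> * (\<kappa> * C - S)"
            using True \<kappa>CS by (intro add_left_mono mult_right_mono_neg) auto
          also have "\<dots> = X j" unfolding X_eq by (simp add: algebra_simps)
          finally show ?thesis .
        next
          case False
          have "s \<le> real a + \<kappa> * \<rho>"
            using s(2) False \<kappa>(1) by (smt (verit) mult_left_mono)
          then have "s * S \<le> (real a + \<kappa> * \<rho>) * S" using S0 by simp
          moreover have "\<tau> * C < \<rho> * C" using False C0 by simp
          ultimately have "y < real a * S + \<rho> * D"
            by (simp add: y_def D_def algebra_simps)
          then show ?thesis using j(1) \<rho>D by simp
        qed
        moreover have "X j - real (Suc a - p j) \<le> x"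
        proof -
          have "x * C + y * S = s * (C * C + S * S)"
            by (simp add: x_def y_def algebra_simps)
          then have xC: "x * C = s - y * S" using CS by simp
          have "X j * C + (real a * S + \<rho> * D) * S = (real a + \<kappa> * \<rho>) * (C * C + S * S)"
            unfolding X_eq D_def by (simp add: algebra_simps)
          then have XC: "X j * C = real a + \<kappa> * \<rho> - (real a * S + real j) * S"
            unfolding CS \<rho>D by simp
          have "y * S \<le> (real a * S + real j + 1) * S" using j(2) S0 by simp
          then have 1: "(X j - x) * C \<le> real a + \<kappa> * \<rho> - real (p j) + S"
            using xC XC 3(2) by (simp add: algebra_simps)
          have "\<kappa> * \<rho> \<le> real (p j) * c"
            using p_ge[of j] c0 D0 by (simp add: \<rho>_def field_simps)
          then have "real a + \<kappa> * \<rho> - real (p j) + S \<le> (n - real (p j)) * C"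
            using nC by (simp add: c_def algebra_simps)
          with 1 have "X j - x \<le> n - real (p j)"
            using C0 by (meson mult_le_cancel_right_pos order_trans)
          then show ?thesis using pn by (simp add: n_def of_nat_diff)
        qed
        ultimately have "(s, \<tau>) \<in> row j"
          using pn j by (simp add: row_def x_def y_def)
        then show ?thesis using 3(1) by blast
      qed
    qed
  qed

  have e_le: "e i \<le> h" if "i < Suc a" for i
  proof -
    have "min (h * C - real a * S) (D * (real i * d)) / C \<le> (h * C - real a * (t * C)) / C"
      using C0 tS by (simp add: divide_right_mono)
    also have "\<dots> = h - real a * t" using C0 by (simp add: field_simps)
    finally have "min (h * C - real a * S) (D * (real i * d)) / C \<le> h - real a * t" .
    moreover have "(real a - real i - 1) * t = real a * t - (real i + 1) * t"
      by (simp add: algebra_simps)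
    moreover have "0 \<le> (real i + 1) * t" using t0 by simp
    ultimately show ?thesis unfolding e_def by linarith
  qed
  have "coverable (top i) ((real a - real i) * t + 1)" if "i < Suc a" for i
  proof -
    have "0 \<le> (real a - real i) * t" using that t0 by simp
    from coverable_unit_column[OF this] show ?thesis unfolding top_def by simp
  qed
  moreover have "coverable (low i) (h - e i + 1)" if "i < Suc a" for i
    unfolding low_def by (rule coverable_unit_column[OF e_le[OF that]])
  ultimately have columns: "coverable (\<Union>i<Suc a. top i \<union> low i)
      (\<Sum>i<Suc a. ((real a - real i) * t + 1) + (h - e i + 1))"
    by (intro coverable_UN coverable_Un) auto
  have "coverable (row j) (real (Suc a - p j))" for j
  proof (cases "p j < Suc a")
    case True
    have box: "coverable ({X j - real (Suc a - p j)..X j} \<times>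
        {real a * S + real j..real a * S + real j + 1}) (real (Suc a - p j) * real 1)"
      using True by (intro coverable_box) auto
    show ?thesis
      by (rule coverable_rotate[where \<phi> = \<phi>, OF box[simplified]])
         (use True in \<open>auto simp: row_def C_def S_def\<close>)
  qed (simp add: row_def coverable_empty)
  then have rows: "coverable (\<Union>j<J. row j) (\<Sum>j<J. real (Suc a - p j))"
    by (intro coverable_UN) auto

  \<comment> \<open>Summing by rows would round \<open>n - p j\<close> once per row. Summing by columns
    rounds only once per column.\<close>
  have "(\<Sum>j<J. Suc a - p j) = (\<Sum>j<J. \<Sum>i<Suc a. if p j \<le> i then 1 else 0)"
  proof (intro sum.cong refl)
    fix j
    have "{..<Suc a} \<inter> {i. p j \<le> i} = {p j..<Suc a}" by auto
    then show "Suc a - p j = (\<Sum>i<Suc a. if p j \<le> i then 1 else 0)"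
      by (simp add: sum.If_cases del: lessThan_Suc sum.lessThan_Suc)
  qed
  also have "\<dots> = (\<Sum>i<Suc a. \<Sum>j<J. if p j \<le> i then 1 else 0)"
    by (rule sum.swap)
  also have "\<dots> = (\<Sum>i<Suc a. card {j. j < J \<and> p j \<le> i})"
    by (intro sum.cong refl) (simp add: sum.If_cases Int_def)
  finally have swap: "(\<Sum>j<J. real (Suc a - p j)) = (\<Sum>i<Suc a. real (card {j. j < J \<and> p j \<le> i}))"
    by (simp only: of_nat_sum[symmetric])
  have card_le: "real (card {j. j < J \<and> p j \<le> i}) \<le> min (h * C - real a * S) (D * (real i * d)) + 1" for i
  proof -
    have "card {j. j < J \<and> p j \<le> i} \<le> card {..<J}"
      by (intro card_mono) auto
    then have 1: "real (card {j. j < J \<and> p j \<le> i}) \<le> h * C - real a * S + 1"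
      using J(2) by simp
    have "{j. j < J \<and> p j \<le> i} \<subseteq> {..nat \<lfloor>D * (real i * d)\<rfloor>}"
      using p_iff by (auto simp: le_nat_iff le_floor_iff)
    then have "card {j. j < J \<and> p j \<le> i} \<le> card {..nat \<lfloor>D * (real i * d)\<rfloor>}"
      by (intro card_mono) auto
    then have "real (card {j. j < J \<and> p j \<le> i}) \<le> real (nat \<lfloor>D * (real i * d)\<rfloor>) + 1"
      by (simp del: of_nat_nat)
    also have "\<dots> \<le> D * (real i * d) + 1"
      using D0 d0 by simp
    finally show ?thesis using 1 by linarith
  qed
  \<comment> \<open>The height of the region that is crossed by rows in the column at the left edge.\<close>
  define g where "g = h - real a * t"
  have g: "0 \<le> g" "g \<le> h" using h t0 by (auto simp: g_def t_def)
  have gC: "h * C - real a * S = g * C"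
    using tS by (simp add: g_def algebra_simps)
  have column_le: "((real a - real i) * t + 1) + (h - e i + 1) + real (card {j. j < J \<and> p j \<le> i})
      \<le> 3 + h + t - c * g + c * max 0 (g - real i * d)" for i
  proof -
    define z where "z = min (h * C - real a * S) (D * (real i * d))"
    define m where "m = min g (real i * d)"
    have m: "m \<le> g" "m \<le> real i * d" "0 \<le> m"
      using g(1) d0 by (simp_all add: m_def)
    have "m * C \<le> g * C" using m(1) C0 by (intro mult_right_mono) auto
    moreover have "m * C \<le> D * (real i * d)"
      using mult_mono[OF DC m(2)] D0 m(3) by (simp add: mult.commute)
    ultimately have "m * C \<le> z" unfolding z_def gC by (rule min.boundedI)
    then have "m \<le> z / C" using C0 by (simp only: pos_le_divide_eq)
    then have "c * m \<le> c * (z / C)" using c0 by (intro mult_left_mono) auto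
    also have "\<dots> = z / C - z" unfolding c_def using C0 by (simp add: field_simps)
    finally have "c * min g (real i * d) \<le> z / C - z" unfolding m_def .
    moreover have "min g (real i * d) = g - max 0 (g - real i * d)" by auto
    ultimately have "c * g - c * max 0 (g - real i * d) \<le> z / C - z"
      by (simp add: right_diff_distrib)
    moreover have "e i = (real a - real i - 1) * t + z / C"
      by (simp only: e_def z_def)
    moreover have "(real a - real i) * t = (real a - real i - 1) * t + t"
      by (simp add: algebra_simps)
    moreover have "real (card {j. j < J \<and> p j \<le> i}) \<le> z + 1"
      unfolding z_def by (rule card_le)
    ultimately show ?thesis by linarith
  qed
  have "coverable (trapezoid (real a) h \<kappa>)
      ((\<Sum>i<Suc a. ((real a - real i) * t + 1) + (h - e i + 1)) + (\<Sum>j<J. real (Suc a - p j)))"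
    by (rule coverable_mono[OF coverable_Un[OF columns rows] subrelI order_refl]) (rule cover_point)
  moreover have "(\<Sum>i<Suc a. ((real a - real i) * t + 1) + (h - e i + 1)) + (\<Sum>j<J. real (Suc a - p j))
      \<le> real a * h + \<kappa> * h\<^sup>2 / 2 + 3 * n + 2 * n * t + h * S + h * c"
  proof -
    have "(\<Sum>i<Suc a. ((real a - real i) * t + 1) + (h - e i + 1)) + (\<Sum>j<J. real (Suc a - p j))
        = (\<Sum>i<Suc a. ((real a - real i) * t + 1) + (h - e i + 1) + real (card {j. j < J \<and> p j \<le> i}))"
      unfolding swap sum.distrib ..
    also have "\<dots> \<le> (\<Sum>i<Suc a. 3 + h + t - c * g + c * max 0 (g - real i * d))"
      by (intro sum_mono column_le)
    also have "\<dots> = n * (3 + h + t - c * g) + c * (\<Sum>i<Suc a. max 0 (g - real i * d))"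
      by (simp add: sum.distrib sum_distrib_left n_def del: sum.lessThan_Suc)
    also have "\<dots> \<le> n * (3 + h + t - c * g) + c * (g + g\<^sup>2 / (2 * d))"
      using sum_truncated_progression_le[OF d0 g(1), of "Suc a"] c0
      by (intro add_left_mono mult_left_mono) auto
    also have "\<dots> = 3 * n + n * h + n * t - (n * c) * g + c * g + \<kappa> * g\<^sup>2 / 2"
    proof -
      have "c * (g + g\<^sup>2 / (2 * d)) = c * g + \<kappa> * g\<^sup>2 / 2"
        using c0 \<kappa>(1) unfolding d_def by (simp add: field_simps)
      then show ?thesis by (simp add: algebra_simps)
    qed
    also have "\<dots> \<le> 3 * n + n * h + n * t - (n * c) * g + c * h + \<kappa> * h\<^sup>2 / 2"
      using c0 \<kappa>(1) g by (intro add_mono mult_left_mono divide_right_mono power_mono order_refl) auto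
    also have "\<dots> = 3 * n + real a * h + n * t + S * h + (1 - S) * (real a * t) + c * h + \<kappa> * h\<^sup>2 / 2"
      unfolding nc by (simp add: g_def n_def algebra_simps)
    also have "(1 - S) * (real a * t) \<le> n * t"
    proof -
      have "0 \<le> 1 - S" using nc n0 c0 by (metis less_imp_le mult_pos_pos)
      then have "(1 - S) * (real a * t) \<le> 1 * (real a * t)"
        using S0 t0 by (intro mult_right_mono) auto
      then show ?thesis using t0 by (simp add: n_def algebra_simps)
    qed
    finally show ?thesis by (simp add: algebra_simps)
  qed
  ultimately have "coverable (trapezoid (real a) h \<kappa>)
      (real a * h + \<kappa> * h\<^sup>2 / 2 + 3 * n + 2 * n * t + h * S + h * c)"
    by (rule coverable_mono[OF _ subset_refl])
  then show ?thesis unfolding t_def S_def c_def C_def .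
qed

section \<open>Layers, tilted strips and integer corners\<close>

text \<open>Each horizontal layer is a rectangle on the left and a translate of one and the same thin
trapezoid on the right. The rectangle absorbs the fractional part of the width, so that the top
edge \<open>a\<close> of the thin trapezoid can be an integer.\<close>

lemma coverable_layered_trapezoid:
  fixes K :: nat and a h w \<kappa> E F :: real
  assumes K: "1 \<le> K" and h: "0 < h" and \<kappa>: "0 \<le> \<kappa>"
    and rect: "\<And>i. i < K \<Longrightarrow> coverable ({0..w + \<kappa> * (real i * h) - a} \<times> {0..h})
      ((w + \<kappa> * (real i * h) - a) * h + E)"
    and thin: "coverable (trapezoid a h \<kappa>) (a * h + \<kappa> * h\<^sup>2 / 2 + F)"
  shows "coverable (trapezoid w (real K * h) \<kappa>)
    (w * (real K * h) + \<kappa> * (real K * h)\<^sup>2 / 2 + real K * (E + F))"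
proof -
  define b where "b i = w + \<kappa> * (real i * h) - a" for i
  define R where "R i = {0..b i} \<times> {real i * h..(real i + 1) * h}" for i
  define T where "T i = {(s, t). b i \<le> s \<and> s \<le> w + \<kappa> * t \<and>
    real i * h \<le> t \<and> t \<le> (real i + 1) * h}" for i
  have "coverable (R i) (b i * h + E)" if "i < K" for i
    by (rule coverable_translate[where a = 0 and b = "real i * h", OF rect[OF that, folded b_def]])
       (auto simp: R_def algebra_simps)
  moreover have "coverable (T i) (a * h + \<kappa> * h\<^sup>2 / 2 + F)" for i
    by (rule coverable_translate[where a = "b i" and b = "real i * h", OF thin])
       (auto simp: T_def b_def trapezoid_def algebra_simps)
  ultimately have layers: "coverable (\<Union>i<K. R i \<union> T i)
      (\<Sum>i<K. (b i * h + E) + (a * h + \<kappa> * h\<^sup>2 / 2 + F))"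
    by (intro coverable_UN coverable_Un) auto
  have "trapezoid w (real K * h) \<kappa> \<subseteq> (\<Union>i<K. R i \<union> T i)"
  proof (rule subrelI)
    fix s t assume st: "(s, t) \<in> trapezoid w (real K * h) \<kappa>"
    then have t: "0 \<le> t" "t \<le> real K * h" and s: "0 \<le> s" "s \<le> w + \<kappa> * t"
      by (auto simp: trapezoid_def)
    have "t / h \<in> {0..real K}"
      using t h by (simp add: pos_divide_le_eq)
    then obtain i where i: "i < K" "real i \<le> t / h" "t / h \<le> real i + 1"
      using interval_subset_unit_steps[of "real K" 0 K] K by auto
    then have "real i * h \<le> t" "t \<le> (real i + 1) * h"
      using h by (simp_all only: pos_le_divide_eq pos_divide_le_eq)
    then have "(s, t) \<in> R i \<union> T i"
      using s by (auto simp: R_def T_def)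
    then show "(s, t) \<in> (\<Union>i<K. R i \<union> T i)" using i(1) by blast
  qed
  then have "coverable (trapezoid w (real K * h) \<kappa>)
      (\<Sum>i<K. (b i * h + E) + (a * h + \<kappa> * h\<^sup>2 / 2 + F))"
    by (rule coverable_mono[OF layers _ order_refl])
  \<comment> \<open>The areas of the first \<open>k\<close> layers add up to the area of a trapezoid of
    height \<open>k * h\<close>.\<close>
  moreover have "(\<Sum>i<k. (b i * h + E) + (a * h + \<kappa> * h\<^sup>2 / 2 + F))
      = w * (real k * h) + \<kappa> * (real k * h)\<^sup>2 / 2 + real k * (E + F)" for k
    by (induction k) (simp_all add: b_def field_simps power2_eq_square)
  ultimately show ?thesis by simp
qed

text \<open>Rods of \<open>N\<close> squares, slightly longer than the height \<open>g\<close> of the strip,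
are tilted until they reach just from one long side to the other; the waste is a sawtooth of
height \<open>sin \<phi>\<close> along the strip. The rods fill a parallelogram, and what remains
at the two ends are right trapezoids. The top width of the trapezoids is only prescribed up to
\<open>2\<close>, which leaves room to make the number of rods an integer; otherwise an incomplete
rod could waste as much as \<open>N\<close>.\<close>

lemma coverable_tilted_strip:
  fixes N :: nat and g L l \<phi> E :: real
  assumes \<phi>: "0 < \<phi>" "\<phi> < pi / 2" "1 / 2 \<le> cos \<phi>" and N: "real N * cos \<phi> = g + sin \<phi>"
    and pos: "0 < g" "0 \<le> l"
    and ends: "\<And>b. l \<le> b \<Longrightarrow> b \<le> l + 2 \<Longrightarrow>
      coverable (trapezoid b g (tan \<phi>)) (b * g + tan \<phi> * g\<^sup>2 / 2 + E)"
    and L: "2 * l + tan \<phi> * g + 2 \<le> L"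
  shows "coverable ({0..L} \<times> {0..g}) (L * g + L * sin \<phi> + 2 * E)"
proof -
  define C S \<kappa> where "C = cos \<phi>" and "S = sin \<phi>" and "\<kappa> = tan \<phi>"
  have C0: "0 < C" and S0: "0 < S"
    using \<phi> by (auto simp: C_def S_def cos_gt_zero sin_gt_zero)
  have CS: "C * C + S * S = 1"
    using sin_cos_squared_add2[of \<phi>] by (simp add: C_def S_def power2_eq_square)
  have \<kappa>C: "\<kappa> * C = S" using C0 by (simp add: \<kappa>_def C_def S_def tan_def)
  have \<kappa>0: "0 < \<kappa>" using \<kappa>C C0 S0 by (metis zero_less_mult_pos2)
  have NC: "real N * C = g + S" using N by (simp only: C_def S_def)
  have N1: "1 \<le> N"
    using NC pos(1) S0 by (cases N) auto
  define W where "W = L - 2 * l - \<kappa> * g"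
  have "2 \<le> W" using L by (simp add: W_def \<kappa>_def)
  then have "2 * (1 / 2) \<le> W * C" using \<phi>(3) C0 by (intro mult_mono) (auto simp: C_def)
  then have WC: "1 \<le> W * C" by simp
  define M where "M = nat \<lfloor>W * C\<rfloor>"
  have M: "real M \<le> W * C" "W * C \<le> real M + 1" "1 \<le> M"
  proof -
    have "real M = of_int \<lfloor>W * C\<rfloor>" unfolding M_def using WC by (intro of_nat_nat) simp
    then show "real M \<le> W * C" "W * C \<le> real M + 1" by linarith+
    show "1 \<le> M" unfolding M_def using WC by (simp add: le_nat_iff)
  qed
  \<comment> \<open>The top width of the right end takes up what the \<open>M\<close> rods leave over.\<close>
  define b where "b = l + (W - real M / C)"
  have b: "l \<le> b" "b \<le> l + 2"
  proof -
    have "real M / C \<le> W" using M(1) C0 by (simp only: pos_divide_le_eq)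
    then show "l \<le> b" by (simp add: b_def)
    have "(W - real M / C) * C \<le> 1" using M(2) C0 by (simp add: left_diff_distrib)
    also have "1 \<le> 2 * C" using \<phi>(3) by (simp add: C_def)
    finally show "b \<le> l + 2" using C0 by (simp add: b_def)
  qed
  define x where "x i = l * C + real i" for i :: nat
  define rod where "rod i = {(s, t). (s * C - t * S, s * S + t * C)
    \<in> {x i..x i + 1} \<times> {x i * S / C..x i * S / C + real N}}" for i
  define right where "right = {(s, t). (L - s, g - t) \<in> trapezoid b g \<kappa>}"
  have "coverable (rod i) (real N)" for i
  proof -
    have box: "coverable ({x i..x i + 1} \<times> {x i * S / C..x i * S / C + real N}) (real 1 * real N)"
      using N1 by (intro coverable_box) auto
    show ?thesis
      by (rule coverable_rotate[where \<phi> = \<phi>, OF box[simplified]]) (simp add: rod_def C_def S_def)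
  qed
  then have mid: "coverable (\<Union>i<M. rod i) (\<Sum>i<M. real N)"
    by (intro coverable_UN) auto
  have left: "coverable (trapezoid l g \<kappa>) (l * g + \<kappa> * g\<^sup>2 / 2 + E)"
    unfolding \<kappa>_def by (rule ends) auto
  have right: "coverable right (b * g + \<kappa> * g\<^sup>2 / 2 + E)"
    by (rule coverable_point_reflect[where a = L and b = g, OF ends[OF b, folded \<kappa>_def]])
       (simp add: right_def)
  have "{0..L} \<times> {0..g} \<subseteq> (\<Union>i<M. rod i) \<union> (trapezoid l g \<kappa> \<union> right)"
  proof (rule subrelI)
    fix s t assume "(s, t) \<in> {0..L} \<times> {0..g}"
    then have st: "0 \<le> s" "s \<le> L" "0 \<le> t" "t \<le> g" by auto
    show "(s, t) \<in> (\<Union>i<M. rod i) \<union> (trapezoid l g \<kappa> \<union> right)"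
    proof (cases "(s, t) \<in> trapezoid l g \<kappa> \<union> right")
      case False
      then have 1: "l \<le> s - \<kappa> * t" and 2: "b + \<kappa> * (g - t) \<le> L - s"
        using st by (auto simp: trapezoid_def right_def)
      define u where "u = s * C - t * S"
      have u: "u = (s - \<kappa> * t) * C" unfolding u_def \<kappa>C[symmetric] by (simp add: algebra_simps)
      have "l * C \<le> u" unfolding u using 1 C0 by simp
      moreover have "u \<le> l * C + real M"
      proof -
        have "s - \<kappa> * t \<le> l + real M / C"
          using 2 by (simp add: b_def W_def right_diff_distrib)
        then have "u \<le> (l + real M / C) * C" unfolding u using C0 by simp
        then show ?thesis using C0 by (simp add: distrib_right)
      qed
      ultimately obtain i where i: "i < M" "x i \<le> u" "u \<le> x i + 1"
        using interval_subset_unit_steps[of "l * C + real M" "l * C" M] M(3)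
        by (auto simp: x_def)
      define v where "v = s * S + t * C"
      have "v * C = t * (C * C + S * S) + u * S"
        by (simp add: v_def u_def algebra_simps)
      then have v: "v * C = t + u * S" using CS by simp
      have uS: "x i * S \<le> u * S" "u * S \<le> (x i + 1) * S"
        using i S0 by simp_all
      have "x i * S \<le> v * C" using v uS st by simp
      then have "x i * S / C \<le> v" using C0 by (simp only: pos_divide_le_eq)
      moreover have "v * C \<le> (x i * S / C + real N) * C"
      proof -
        have "(x i * S / C + real N) * C = x i * S + (g + S)"
          using C0 NC by (simp add: distrib_right)
        then show ?thesis using v uS(2) st(4) by (simp add: distrib_right)
      qed
      then have "v \<le> x i * S / C + real N" using C0 by simp
      ultimately have "(s, t) \<in> rod i"
        using i by (simp add: rod_def u_def v_def)
      then show ?thesis using i(1) by blast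
    qed blast
  qed
  then have "coverable ({0..L} \<times> {0..g})
      ((\<Sum>i<M. real N) + ((l * g + \<kappa> * g\<^sup>2 / 2 + E) + (b * g + \<kappa> * g\<^sup>2 / 2 + E)))"
    by (rule coverable_mono[OF coverable_Un[OF mid coverable_Un[OF left right]] _ order_refl])
  moreover have "(\<Sum>i<M. real N) + ((l * g + \<kappa> * g\<^sup>2 / 2 + E) + (b * g + \<kappa> * g\<^sup>2 / 2 + E))
      \<le> L * g + L * S + 2 * E"
  proof -
    have "real N = (g + S) / C" using NC C0 by (metis less_irrefl nonzero_mult_div_cancel_right)
    then have "real M * real N = (real M / C) * g + (real M / C) * S"
      by (simp add: distrib_left add_divide_distrib)
    moreover have "real M / C = L - l - b - \<kappa> * g"
      by (simp add: b_def W_def)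
    moreover have "(L - l - b - \<kappa> * g) * S \<le> L * S"
      using pos b(1) S0 mult_pos_pos[OF \<kappa>0 pos(1)] by (intro mult_right_mono) auto
    ultimately show ?thesis
      by (simp add: algebra_simps power2_eq_square)
  qed
  ultimately show ?thesis
    unfolding S_def by (rule coverable_mono[OF _ subset_refl])
qed

text \<open>A rectangle with integer sides is cut off at the corner; it wastes nothing, and two strips of
non-integer width remain.\<close>

lemma coverable_rectangle_split:
  fixes k m :: nat and x y g g' F F' :: real
  assumes "x = real k + g" "y = real m + g'" "0 \<le> g" "0 \<le> g'"
    and "coverable ({0..real k} \<times> {0..g'}) (real k * g' + F')"
    and "coverable ({0..y} \<times> {0..g}) (y * g + F)"
  shows "coverable ({0..x} \<times> {0..y}) (x * y + F + F')"
proof -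
  \<comment> \<open>If one side of the corner rectangle is zero, the two strips already cover it.\<close>
  define core where "core = (if k = 0 \<or> m = 0 then {} else {0..real k} \<times> {0..real m})"
  have core: "coverable core (real k * real m)"
    unfolding core_def using coverable_box[of "real k" 0 k "real m" 0 m]
    by (auto simp: coverable_empty)
  have top: "coverable ({0..real k} \<times> {real m..y}) (real k * g' + F')"
    by (rule coverable_translate[where a = 0 and b = "real m", OF assms(5)])
       (auto simp: assms(2))
  have side: "coverable ({real k..x} \<times> {0..y}) (y * g + F)"
  proof -
    have "coverable ({0..g} \<times> {0..y}) (y * g + F)"
      by (rule coverable_transpose[OF assms(6)]) auto
    then show ?thesis
      by (rule coverable_translate[where a = "real k" and b = 0]) (auto simp: assms(1))
  qed
  have "{0..x} \<times> {0..y} \<subseteq> core \<union> ({0..real k} \<times> {real m..y} \<union> {real k..x} \<times> {0..y})"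
  proof (rule subrelI)
    fix s t assume "(s, t) \<in> {0..x} \<times> {0..y}"
    then show "(s, t) \<in> core \<union> ({0..real k} \<times> {real m..y} \<union> {real k..x} \<times> {0..y})"
      by (cases "s \<le> real k"; cases "t \<le> real m") (auto simp: core_def)
  qed
  then have "coverable ({0..x} \<times> {0..y}) (real k * real m + ((real k * g' + F') + (y * g + F)))"
    by (rule coverable_mono[OF coverable_Un[OF core coverable_Un[OF top side]] _ order_refl])
  moreover have "real k * real m + ((real k * g' + F') + (y * g + F)) = x * y + F + F'"
    by (simp add: assms(1,2) algebra_simps)
  ultimately show ?thesis by simp
qed

section \<open>Bootstrapping between rectangles and trapezoids\<close>

lemma tilt_exists:
  fixes n e :: real
  assumes "1 \<le> n" "0 < e" "e \<le> 1"
  obtains \<phi> where "0 < \<phi>" "\<phi> < pi / 2" "n * (1 - cos \<phi>) + sin \<phi> = e"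
proof -
  define f where "f \<phi> = n * (1 - cos \<phi>) + sin \<phi>" for \<phi>
  have "\<exists>\<phi>\<ge>0. \<phi> \<le> pi / 2 \<and> f \<phi> = e"
    by (rule IVT') (use assms in \<open>auto simp: f_def intro!: continuous_intros\<close>)
  then obtain \<phi> where \<phi>: "0 \<le> \<phi>" "\<phi> \<le> pi / 2" "f \<phi> = e" by blast
  have "\<phi> \<noteq> 0" "\<phi> \<noteq> pi / 2"
  proof -
    have "f 0 = 0" "f (pi / 2) = n + 1" by (simp_all add: f_def)
    then have "f \<phi> \<noteq> f 0" "f \<phi> \<noteq> f (pi / 2)" using \<phi>(3) assms by simp_all
    then show "\<phi> \<noteq> 0" "\<phi> \<noteq> pi / 2" by blast+
  qed
  then show thesis
    using \<phi> by (intro that[of \<phi>]) (auto simp: f_def)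
qed

text \<open>All that is needed about the angle: \<open>sin \<phi>\<close> and \<open>tan \<phi>\<close> are of
order \<open>1 / sqrt n\<close>, and \<open>1 - cos \<phi>\<close> is of order \<open>1 /
n\<close>.\<close>

lemma tilt_bounds:
  fixes n e \<phi> :: real
  assumes "0 < \<phi>" "\<phi> < pi / 2" "n * (1 - cos \<phi>) + sin \<phi> = e" "e \<le> 1" "0 < n"
  shows "n * (sin \<phi>)\<^sup>2 \<le> 2" "1 - cos \<phi> \<le> 1 / n" "e \<le> n * (sin \<phi>)\<^sup>2 + sin \<phi>"
    "0 < sin \<phi>" "0 < cos \<phi>"
proof -
  show S: "0 < sin \<phi>" and C: "0 < cos \<phi>"
    using assms(1,2) by (auto simp: sin_gt_zero cos_gt_zero)
  have c0: "0 \<le> 1 - cos \<phi>" by simp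
  have nc: "n * (1 - cos \<phi>) \<le> 1" using assms(3,4) S by simp
  then show "1 - cos \<phi> \<le> 1 / n" using assms(5) by (simp add: pos_le_divide_eq mult.commute)
  have sq: "(sin \<phi>)\<^sup>2 = (1 - cos \<phi>) * (1 + cos \<phi>)"
    by (simp add: sin_squared_eq power2_eq_square algebra_simps)
  have "n * (sin \<phi>)\<^sup>2 = (n * (1 - cos \<phi>)) * (1 + cos \<phi>)" by (simp add: sq)
  also have "\<dots> \<le> 1 * 2" using nc assms(5) C c0 by (intro mult_mono) auto
  finally show "n * (sin \<phi>)\<^sup>2 \<le> 2" by simp
  have "(1 - cos \<phi>) * 1 \<le> (sin \<phi>)\<^sup>2" unfolding sq using C c0 by (intro mult_left_mono) auto
  then have "n * (1 - cos \<phi>) \<le> n * (sin \<phi>)\<^sup>2" using assms(5) by (intro mult_left_mono) auto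
  then show "e \<le> n * (sin \<phi>)\<^sup>2 + sin \<phi>" using assms(3) by simp
qed

text \<open>For a trapezoid of height about \<open>q\<^sup>3 / 2\<close> and width about
\<open>q\<^sup>2\<close> the tilt \<open>\<phi>\<close> is of order \<open>1 / q\<close>. The
rounding term \<open>3 * n\<close> and the sawtooth term \<open>h * sin \<phi>\<close> of the
covering bound are then both of order \<open>q\<^sup>2\<close>, at most \<open>3 *
q\<^sup>2\<close> and \<open>1.2 * q\<^sup>2\<close>, while the other terms are of order
\<open>q\<close>.\<close>

lemma thin_trapezoid_excess:
  fixes a :: nat and q h \<kappa> :: real
  assumes q: "20 \<le> q" and a: "q\<^sup>2 / 2 \<le> real a + 1" "real a + 1 \<le> q\<^sup>2"
    and h: "4 / 10 * q ^ 3 \<le> h" "h \<le> 6 / 10 * q ^ 3" and \<kappa>: "0 < \<kappa>" "\<kappa> \<le> (3 / 2) / q ^ 3"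
  shows "coverable (trapezoid (real a) h \<kappa>) (real a * h + \<kappa> * h\<^sup>2 / 2 + 5 * q\<^sup>2)"
proof -
  define n where "n = real a + 1"
  have q0: "0 < q" and n1: "1 \<le> n" using q by (auto simp: n_def)
  have qq: "20 * q \<le> q\<^sup>2" using q by (simp add: power2_eq_square)
  have q3: "q ^ 3 = q\<^sup>2 * q" by (simp add: power2_eq_square power3_eq_cube)
  have q3': "400 * q \<le> q ^ 3" unfolding q3 using qq q by (intro mult_right_mono) auto
  obtain \<phi> where \<phi>: "0 < \<phi>" "\<phi> < pi / 2" "n * (1 - cos \<phi>) + sin \<phi> = 1"
    using tilt_exists[of n 1] n1 by auto
  define S c where "S = sin \<phi>" and "c = 1 - cos \<phi>"
  have S: "n * S\<^sup>2 \<le> 2" "1 \<le> n * S\<^sup>2 + S" "0 < S" and c: "c \<le> 1 / n" "0 < cos \<phi>"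
    using tilt_bounds[OF \<phi>] n1 by (auto simp: S_def c_def)
  have nq: "q\<^sup>2 / 2 \<le> n" "n \<le> q\<^sup>2" using a by (auto simp: n_def)
  have S_le: "S * q \<le> 2"
  proof (rule power2_le_imp_le)
    have "(S * q)\<^sup>2 / 2 = q\<^sup>2 / 2 * S\<^sup>2" by (simp add: power_mult_distrib)
    also have "\<dots> \<le> n * S\<^sup>2" using nq by (intro mult_right_mono) auto
    finally show "(S * q)\<^sup>2 \<le> 2\<^sup>2" using S(1) by simp
  qed simp
  have S_ge: "1 \<le> 2 * (S * q)"
  proof (rule ccontr)
    assume "\<not> 1 \<le> 2 * (S * q)"
    then have less: "S * q < 1 / 2" by simp
    have "S * 20 \<le> S * q" using S q by simp
    then have "S < 1 / 2" using less by simp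
    have "n * S\<^sup>2 \<le> q\<^sup>2 * S\<^sup>2" using nq by (intro mult_right_mono) auto
    also have "\<dots> = (S * q)\<^sup>2" by (simp add: power_mult_distrib)
    also have "\<dots> \<le> (1 / 2)\<^sup>2" using less S q0 by (intro power_mono) auto
    also have "\<dots> \<le> 1 / 2" by (simp add: power2_eq_square)
    finally show False using S(2) \<open>S < 1 / 2\<close> by linarith
  qed
  have nc: "c * (q\<^sup>2 / 2) \<le> 1"
  proof -
    have "0 \<le> c" by (simp add: c_def)
    then have "c * (q\<^sup>2 / 2) \<le> c * n" using nq by (intro mult_left_mono)
    also have "c * n \<le> 1" using c(1) n1 by (simp add: pos_le_divide_eq)
    finally show ?thesis .
  qed
  have S_small: "S \<le> 1 / 10"
  proof -
    have "S * 20 \<le> S * q" using S q by simp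
    then show ?thesis using S_le by simp
  qed
  have "c \<le> 1 / 2"
  proof -
    have "c * 200 \<le> c * (q\<^sup>2 / 2)"
      using qq q by (intro mult_left_mono) (auto simp: c_def)
    then show ?thesis using nc by simp
  qed
  then have cos_ge: "1 / 2 \<le> cos \<phi>" by (simp add: c_def)
  have tan: "S \<le> tan \<phi>" "tan \<phi> \<le> 2 * S"
  proof -
    have "tan \<phi> * cos \<phi> = S" using c(2) by (simp add: tan_def S_def)
    moreover have "0 < tan \<phi>" using \<phi> by (simp add: tan_gt_zero)
    ultimately show "S \<le> tan \<phi>" "tan \<phi> \<le> 2 * S"
      using cos_ge mult_left_mono[of "1 / 2" "cos \<phi>" "tan \<phi>"] mult_left_mono[of "cos \<phi>" 1 "tan \<phi>"] by auto
  qed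
  have nS: "n * S \<le> 2 * q"
  proof -
    have "n * S \<le> q\<^sup>2 * S" using nq S by (intro mult_right_mono) auto
    also have "\<dots> = q * (S * q)" by (simp add: power2_eq_square)
    also have "\<dots> \<le> q * 2" using S_le q0 by (intro mult_left_mono) auto
    finally show ?thesis by simp
  qed
  have ntan: "n * tan \<phi> \<le> 4 * q"
  proof -
    have "n * tan \<phi> \<le> n * (2 * S)" using tan(2) n1 by (intro mult_left_mono) auto
    then show ?thesis using nS by linarith
  qed
  have h0: "0 < h" using h(1) q3' q0 by linarith
  have "coverable (trapezoid (real a) h \<kappa>)
    (real a * h + \<kappa> * h\<^sup>2 / 2 + 3 * (real a + 1) + 2 * (real a + 1) * tan \<phi> + h * sin \<phi> + h * (1 - cos \<phi>))"
  proof (rule coverable_thin_trapezoid)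
    show "(real a + 1) * (1 - cos \<phi>) + sin \<phi> = 1" using \<phi>(3) by (simp add: n_def)
    have "\<kappa> * q ^ 3 \<le> 3 / 2" using \<kappa>(2) q0 by (simp add: pos_le_divide_eq)
    have "\<kappa> * (400 * q) \<le> \<kappa> * q ^ 3" using q3' \<kappa> by (intro mult_left_mono) auto
    then have "\<kappa> * (400 * q) \<le> 3 / 2" using \<open>\<kappa> * q ^ 3 \<le> 3 / 2\<close> by linarith
    then have "\<kappa> * q \<le> S * q" using S_ge by linarith
    then have "\<kappa> \<le> S" using q0 by simp
    then show "\<kappa> \<le> tan \<phi>" using tan(1) by linarith
    have "h * \<kappa> \<le> (6 / 10 * q ^ 3) * \<kappa>" using h \<kappa> by (intro mult_right_mono) auto
    also have "\<dots> = 6 / 10 * (\<kappa> * q ^ 3)" by simp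
    also have "\<dots> \<le> 9 / 10" using \<open>\<kappa> * q ^ 3 \<le> 3 / 2\<close> by simp
    finally show "h * \<kappa> \<le> 1 - sin \<phi>" using S_small by (simp add: S_def)
    have "real a * tan \<phi> \<le> n * tan \<phi>" using tan S by (intro mult_right_mono) (auto simp: n_def)
    then show "real a * tan \<phi> \<le> h" using ntan h(1) q3' q0 by linarith
  qed (use \<phi> \<kappa> in auto)
  then show ?thesis
  proof (rule coverable_mono[OF _ subset_refl])
    have "h * S \<le> (6 / 10 * q ^ 3) * S" using h S by (intro mult_right_mono) auto
    also have "\<dots> = 6 / 10 * q\<^sup>2 * (S * q)" by (simp add: q3)
    also have "\<dots> \<le> 6 / 10 * q\<^sup>2 * 2" using S_le by (intro mult_left_mono) auto
    finally have 1: "h * S \<le> 12 / 10 * q\<^sup>2" by simp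
    have "h * c \<le> (6 / 10 * q ^ 3) * c" using h by (intro mult_right_mono) (auto simp: c_def)
    also have "\<dots> = 12 / 10 * q * (c * (q\<^sup>2 / 2))" by (simp add: q3)
    also have "\<dots> \<le> 12 / 10 * q * 1" using nc q0 by (intro mult_left_mono) auto
    finally have 2: "h * c \<le> 12 / 10 * q" by simp
    have 3: "2 * (real a + 1) * tan \<phi> \<le> 8 * q"
      using ntan by (simp only: n_def mult.assoc)
    have "real a * h + \<kappa> * h\<^sup>2 / 2 + 3 * (real a + 1) + 2 * (real a + 1) * tan \<phi> + h * sin \<phi> + h * (1 - cos \<phi>)
      \<le> real a * h + \<kappa> * h\<^sup>2 / 2 + 3 * q\<^sup>2 + 8 * q + 12 / 10 * q\<^sup>2 + 12 / 10 * q"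
      using a(2) by (intro add_mono order_refl 3 1[unfolded S_def] 2[unfolded c_def]) simp
    also have "\<dots> \<le> real a * h + \<kappa> * h\<^sup>2 / 2 + 5 * q\<^sup>2"
      using qq q0 by linarith
    finally show "real a * h + \<kappa> * h\<^sup>2 / 2 + 3 * (real a + 1) + 2 * (real a + 1) * tan \<phi> + h * sin \<phi> + h * (1 - cos \<phi>)
      \<le> real a * h + \<kappa> * h\<^sup>2 / 2 + 5 * q\<^sup>2" .
  qed
qed

text \<open>The excess over the area is at most of order \<open>x\<^sup>\<beta>\<close> for rectangles of
bounded aspect ratio. The factor \<open>10\<close> accommodates the rectangles in the layers of a
tall trapezoid, whose width is at most nine times their height.\<close>

definition rectangle_bound :: "real \<Rightarrow> bool" where
  "rectangle_bound \<beta> \<longleftrightarrow> (\<exists>C>0. \<forall>\<^sub>F x in at_top. \<forall>y. x powr (3/4) \<le> y \<and> y \<le> 10 * x \<longrightarrow>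
     coverable ({0..x} \<times> {0..y}) (x * y + C * x powr \<beta>))"

text \<open>The ends of a tilted strip have a top edge of about \<open>2 * sqrt x\<close> and a slope of at
most about \<open>sqrt (2 / x)\<close>. The margins around these values leave room for lower order
terms.\<close>

definition trapezoid_bound :: "real \<Rightarrow> real \<Rightarrow> bool" where
  "trapezoid_bound C \<gamma> \<longleftrightarrow> (\<forall>\<^sub>F x in at_top. \<forall>w \<kappa>.
     19 / 10 * sqrt x \<le> w \<and> w \<le> 21 / 10 * sqrt x \<and> 0 < \<kappa> \<and> \<kappa> \<le> (3 / 2) / sqrt x \<longrightarrow>
     coverable (trapezoid w x \<kappa>) (w * x + \<kappa> * x\<^sup>2 / 2 + C * x powr \<gamma>))"

lemma rectangle_bound_trivial: "rectangle_bound 1"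
  unfolding rectangle_bound_def
proof (intro exI[of _ 12] conjI)
  show "\<forall>\<^sub>F x in at_top. \<forall>y. x powr (3/4) \<le> y \<and> y \<le> 10 * x \<longrightarrow>
     coverable ({0..x} \<times> {0..y}) (x * y + 12 * x powr 1)"
    using eventually_ge_at_top[of 1]
  proof eventually_elim
    case (elim x)
    show ?case
    proof (intro allI impI)
      fix y assume y: "x powr (3/4) \<le> y \<and> y \<le> 10 * x"
      then have "0 \<le> y" by (meson order_trans powr_ge_zero)
      then have "coverable ({0..x} \<times> {0..y}) ((x + 1) * (y + 1))"
        using elim by (intro coverable_rectangle_trivial) auto
      then show "coverable ({0..x} \<times> {0..y}) (x * y + 12 * x powr 1)"
        by (rule coverable_mono[OF _ subset_refl]) (use y elim in \<open>simp add: algebra_simps\<close>)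
    qed
  qed
qed simp

text \<open>With \<open>x = q ^ 6\<close>, the trapezoid is cut into about \<open>2 * q ^ 3\<close> layers of
height about \<open>q ^ 3 / 2\<close>. Each layer contributes the excess of one rectangle with
sides of order \<open>q ^ 3\<close> and that of one thin trapezoid.\<close>

lemma trapezoid_cover_from_rectangles:
  assumes "0 < C"
    and rect: "\<forall>\<^sub>F x in at_top. \<forall>y. x powr (3/4) \<le> y \<and> y \<le> 10 * x \<longrightarrow>
     coverable ({0..x} \<times> {0..y}) (x * y + C * x powr \<beta>)" and "0 \<le> \<beta>"
  shows "\<forall>\<^sub>F q in at_top. \<forall>w \<kappa>. 19 / 10 * q ^ 3 \<le> w \<and> w \<le> 21 / 10 * q ^ 3 \<and> 0 < \<kappa> \<and> \<kappa> \<le> (3 / 2) / q ^ 3 \<longrightarrow>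
     coverable (trapezoid w (q ^ 6) \<kappa>)
       (w * q ^ 6 + \<kappa> * (q ^ 6)\<^sup>2 / 2 + (2 * q ^ 3 + 1) * (C * (q ^ 3) powr \<beta> + 5 * q\<^sup>2))"
proof -
  obtain x0 where x0: "\<And>x y. x0 \<le> x \<Longrightarrow> x powr (3/4) \<le> y \<Longrightarrow> y \<le> 10 * x \<Longrightarrow>
     coverable ({0..x} \<times> {0..y}) (x * y + C * x powr \<beta>)"
    using rect unfolding eventually_at_top_linorder by blast
  have "\<forall>\<^sub>F q in at_top. x0 \<le> 4 / 10 * q ^ 3" by real_asymp
  then show ?thesis
    using eventually_ge_at_top[of 20]
  proof eventually_elim
    case (elim q)
    have q: "20 \<le> q" "0 < q" using elim by auto
    have q3: "8000 \<le> q ^ 3" using power_mono[OF q(1), of 3] by simp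
    have q23: "20 * q\<^sup>2 \<le> q ^ 3"
      using q mult_right_mono[of 20 q "q\<^sup>2"] by (simp add: power2_eq_square power3_eq_cube)
    have q2: "400 \<le> q\<^sup>2" using power_mono[OF q(1), of 2] by simp
    have q6: "q ^ 6 = q ^ 3 * q ^ 3" by (simp add: power_add[symmetric])
    show ?case
    proof (intro allI impI, elim conjE)
      fix w \<kappa> assume w: "19 / 10 * q ^ 3 \<le> w" "w \<le> 21 / 10 * q ^ 3" and \<kappa>: "0 < \<kappa>" "\<kappa> \<le> (3 / 2) / q ^ 3"
      define K where "K = nat \<lceil>2 * q ^ 3\<rceil>"
      have K: "2 * q ^ 3 \<le> real K" "real K \<le> 2 * q ^ 3 + 1"
      proof -
        have "real K = of_int \<lceil>2 * q ^ 3\<rceil>"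
          unfolding K_def using q3 by (intro of_nat_nat) linarith
        then show "2 * q ^ 3 \<le> real K" "real K \<le> 2 * q ^ 3 + 1" by linarith+
      qed
      have K0: "0 < real K" using K(1) q3 by linarith
      define h where "h = q ^ 6 / real K"
      have Kh: "real K * h = q ^ 6" using K0 by (simp add: h_def)
      have h0: "0 < h" using K0 q by (simp add: h_def)
      have h_le: "h \<le> 1 / 2 * q ^ 3"
      proof -
        have "q ^ 6 \<le> 1 / 2 * q ^ 3 * real K"
          unfolding q6 using mult_left_mono[OF K(1), of "1 / 2 * q ^ 3"] q by simp
        then show ?thesis unfolding h_def using K0 by (simp only: pos_divide_le_eq)
      qed
      have h_ge: "4 / 10 * q ^ 3 \<le> h"
      proof -
        have "4 / 10 * q ^ 3 * real K \<le> 4 / 10 * q ^ 3 * (25 / 10 * q ^ 3)"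
          using K(2) q3 q by (intro mult_left_mono) auto
        also have "\<dots> = q ^ 6" unfolding q6 by simp
        finally show ?thesis unfolding h_def using K0 by (simp only: pos_le_divide_eq)
      qed
      define a where "a = nat \<lfloor>q\<^sup>2\<rfloor> - 1"
      have a: "q\<^sup>2 - 1 \<le> real a + 1" "real a + 1 \<le> q\<^sup>2"
      proof -
        have r: "real (nat \<lfloor>q\<^sup>2\<rfloor>) = of_int \<lfloor>q\<^sup>2\<rfloor>"
          by (intro of_nat_nat) simp
        have "1 \<le> nat \<lfloor>q\<^sup>2\<rfloor>" using q2 by (simp add: le_nat_iff)
        then have "real a + 1 = of_int \<lfloor>q\<^sup>2\<rfloor>" unfolding a_def using r by (simp add: of_nat_diff)
        then show "q\<^sup>2 - 1 \<le> real a + 1" "real a + 1 \<le> q\<^sup>2" by linarith+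
      qed
      have thin: "coverable (trapezoid (real a) h \<kappa>) (real a * h + \<kappa> * h\<^sup>2 / 2 + 5 * q\<^sup>2)"
        using q2 q3 by (intro thin_trapezoid_excess q(1) a(2) h_ge \<kappa>) (use a h_le in linarith)+
      have rects: "coverable ({0..w + \<kappa> * (real i * h) - real a} \<times> {0..h})
          ((w + \<kappa> * (real i * h) - real a) * h + C * (q ^ 3) powr \<beta>)" if "i < K" for i
      proof -
        define b where "b = w + \<kappa> * (real i * h) - real a"
        have ih: "0 \<le> real i * h" "real i * h \<le> q ^ 6"
          using that h0 Kh mult_right_mono[of "real i" "real K" h] by auto
        have "0 \<le> \<kappa> * (real i * h)" using \<kappa>(1) ih(1) by simp
        moreover have "\<kappa> * (real i * h) \<le> (3 / 2) / q ^ 3 * q ^ 6"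
          using \<kappa> ih q by (intro mult_mono) auto
        moreover have "(3 / 2) / q ^ 3 * q ^ 6 = 3 / 2 * q ^ 3"
        proof -
          have "(3 / 2) / r * (r * r) = 3 / 2 * r" if "0 < r" for r :: real
            using that by simp
          from this[of "q ^ 3"] show ?thesis unfolding q6 using q by simp
        qed
        ultimately have b: "q ^ 3 \<le> b" "b \<le> 36 / 10 * q ^ 3"
          unfolding b_def using w a q23 by linarith+
        have h1: "1 \<le> h" using h_ge q3 by linarith
        have "h powr (3/4) \<le> h powr 1" using h1 by (intro powr_mono) auto
        then have "h powr (3/4) \<le> b" using b h_le h1 by simp
        moreover have "b \<le> 10 * h" using b h_ge by linarith
        ultimately have "coverable ({0..h} \<times> {0..b}) (h * b + C * h powr \<beta>)"
          using elim h_ge by (intro x0) auto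
        then have cov: "coverable ({0..b} \<times> {0..h}) (h * b + C * h powr \<beta>)"
          by (rule coverable_transpose) auto
        have "C * h powr \<beta> \<le> C * (q ^ 3) powr \<beta>"
          using assms h0 h_le q by (intro mult_left_mono powr_mono2) auto
        then have "h * b + C * h powr \<beta> \<le> b * h + C * (q ^ 3) powr \<beta>" by simp
        then show ?thesis
          unfolding b_def[symmetric] by (rule coverable_mono[OF cov subset_refl])
      qed
      have K1: "1 \<le> K" using K0 by (cases K) auto
      have "coverable (trapezoid w (real K * h) \<kappa>)
          (w * (real K * h) + \<kappa> * (real K * h)\<^sup>2 / 2 + real K * (C * (q ^ 3) powr \<beta> + 5 * q\<^sup>2))"
        using \<kappa>(1) by (intro coverable_layered_trapezoid[OF K1 h0 _ rects thin]) auto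
      then show "coverable (trapezoid w (q ^ 6) \<kappa>)
          (w * q ^ 6 + \<kappa> * (q ^ 6)\<^sup>2 / 2 + (2 * q ^ 3 + 1) * (C * (q ^ 3) powr \<beta> + 5 * q\<^sup>2))"
        unfolding Kh
        by (rule coverable_mono[OF _ subset_refl])
           (use K(2) assms(1) in \<open>simp add: mult_right_mono\<close>)
    qed
  qed
qed

lemma trapezoid_bound_from_rectangles:
  assumes "0 < C"
    and "\<forall>\<^sub>F x in at_top. \<forall>y. x powr (3/4) \<le> y \<and> y \<le> 10 * x \<longrightarrow>
     coverable ({0..x} \<times> {0..y}) (x * y + C * x powr \<beta>)" and "0 \<le> \<beta>"
    and le: "\<forall>\<^sub>F x in at_top. (2 * x powr (1/2) + 1) * (C * x powr (\<beta> / 2) + 5 * x powr (1/3)) \<le> D * x powr \<gamma>"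
  shows "trapezoid_bound D \<gamma>"
proof -
  have lim: "filterlim (\<lambda>x::real. x powr (1/6)) at_top at_top" by real_asymp
  note ev = eventually_compose_filterlim[OF trapezoid_cover_from_rectangles[OF assms(1-3)] lim]
  show ?thesis
    unfolding trapezoid_bound_def
    using ev le eventually_gt_at_top[of 0]
  proof eventually_elim
    case (elim x)
    define q where "q = x powr (1/6)"
    have q6: "q ^ 6 = x" and q3: "q ^ 3 = x powr (1/2)" and q2: "q\<^sup>2 = x powr (1/3)"
      using elim(3) by (simp_all add: q_def powr_power)
    have q3': "q ^ 3 = sqrt x" using q3 elim(3) by (simp add: powr_half_sqrt)
    have "(q ^ 3) powr \<beta> = x powr (\<beta> / 2)"
      by (simp add: q3 powr_powr)
    then have le: "(2 * q ^ 3 + 1) * (C * (q ^ 3) powr \<beta> + 5 * q\<^sup>2) \<le> D * x powr \<gamma>"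
      using elim(2) by (simp only: q3 q2)
    show ?case
      using elim(1)[folded q_def, unfolded q6] le[unfolded q3'] unfolding q3'
      by (meson add_left_mono coverable_mono subset_refl)
  qed
qed

text \<open>Rods of \<open>N = \<lfloor>g\<rfloor> + 1\<close> squares exceed the height by \<open>N -
g\<close>, between \<open>0\<close> and \<open>1\<close>, which fixes the tilt; it is positive
because \<open>N\<close> is strictly larger than \<open>g\<close>.\<close>

lemma strip_cover_from_trapezoids:
  assumes "trapezoid_bound C \<gamma>"
  shows "\<forall>\<^sub>F g in at_top. \<forall>L. 6 * sqrt g \<le> L \<longrightarrow>
    coverable ({0..L} \<times> {0..g}) (L * g + L * ((3 / 2) / sqrt g) + 2 * (C * g powr \<gamma>))"
  using assms[unfolded trapezoid_bound_def] eventually_ge_at_top[of 400]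
proof eventually_elim
  case (elim g)
  define r where "r = sqrt g"
  have "sqrt 400 \<le> r" unfolding r_def using elim(2) by (rule real_sqrt_le_mono)
  moreover have "sqrt 400 = (20::real)" by (rule real_sqrt_unique) auto
  ultimately have r: "20 \<le> r" "r * r = g" using elim(2) by (auto simp: r_def)
  define N where "N = nat \<lfloor>g\<rfloor> + 1"
  have N: "g < real N" "real N \<le> g + 1"
  proof -
    have "real N = of_int \<lfloor>g\<rfloor> + 1"
      unfolding N_def using elim(2) by simp
    then show "g < real N" "real N \<le> g + 1" by linarith+
  qed
  define e where "e = real N - g"
  obtain \<phi> where \<phi>: "0 < \<phi>" "\<phi> < pi / 2" "real N * (1 - cos \<phi>) + sin \<phi> = e"
    using tilt_exists[of "real N" e] N elim(2) by (auto simp: e_def)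
  have N0: "0 < real N" using N elim(2) by linarith
  have b: "real N * (sin \<phi>)\<^sup>2 \<le> 2" "1 - cos \<phi> \<le> 1 / real N" "0 < sin \<phi>" "0 < cos \<phi>"
    using tilt_bounds[OF \<phi> _ N0] N by (auto simp: e_def)
  have cos_ge: "19 / 20 \<le> cos \<phi>"
  proof -
    have "1 / real N \<le> 1 / 20" using N elim(2) by (intro divide_left_mono) auto
    then show ?thesis using b(2) by simp
  qed
  have sin_le: "sin \<phi> * r \<le> 142 / 100"
  proof (rule power2_le_imp_le)
    have "(sin \<phi> * r)\<^sup>2 = g * (sin \<phi>)\<^sup>2" using r(2) by (simp add: power2_eq_square)
    also have "\<dots> \<le> real N * (sin \<phi>)\<^sup>2" using N by (intro mult_right_mono) auto
    finally show "(sin \<phi> * r)\<^sup>2 \<le> (142 / 100)\<^sup>2" using b(1) by (simp add: power2_eq_square)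
  qed simp
  have tan_le: "tan \<phi> * r \<le> 3 / 2"
  proof -
    have t0: "0 < tan \<phi>" using \<phi> by (simp add: tan_gt_zero)
    have "tan \<phi> * (19 / 20) \<le> tan \<phi> * cos \<phi>" using cos_ge t0 by (intro mult_left_mono) auto
    also have "\<dots> = sin \<phi>" using b(4) by (simp add: tan_def)
    finally have "tan \<phi> * (19 / 20) * r \<le> sin \<phi> * r" using r by (intro mult_right_mono) auto
    then show ?thesis using sin_le by simp
  qed
  show ?case
  proof (intro allI impI)
    fix L assume L: "6 * sqrt g \<le> L"
    have "coverable ({0..L} \<times> {0..g}) (L * g + L * sin \<phi> + 2 * (C * g powr \<gamma>))"
    proof (rule coverable_tilted_strip[where N = N and l = "195 / 100 * r"])
      show "real N * cos \<phi> = g + sin \<phi>" using \<phi>(3) by (simp add: e_def algebra_simps)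
      show "1 / 2 \<le> cos \<phi>" using cos_ge by simp
      have "tan \<phi> * g \<le> 3 / 2 * r"
        using mult_right_mono[OF tan_le, of r] r by (simp add: mult.assoc)
      then show "2 * (195 / 100 * r) + tan \<phi> * g + 2 \<le> L" using L r unfolding r_def by linarith
      fix b assume "195 / 100 * r \<le> b" "b \<le> 195 / 100 * r + 2"
      then show "coverable (trapezoid b g (tan \<phi>)) (b * g + tan \<phi> * g\<^sup>2 / 2 + C * g powr \<gamma>)"
        using r tan_le \<phi> by (intro elim(1)[rule_format, folded r_def])
          (simp add: tan_gt_zero pos_le_divide_eq)
    qed (use \<phi> elim(2) r in auto)
    moreover have "L * sin \<phi> \<le> L * ((3 / 2) / sqrt g)"
    proof (rule mult_left_mono)
      show "sin \<phi> \<le> (3 / 2) / sqrt g"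
        unfolding r_def[symmetric] using sin_le r by (simp add: pos_le_divide_eq)
      show "0 \<le> L" using L r(1) unfolding r_def by linarith
    qed
    ultimately show "coverable ({0..L} \<times> {0..g}) (L * g + L * ((3 / 2) / sqrt g) + 2 * (C * g powr \<gamma>))"
      by (rule_tac coverable_mono[OF _ subset_refl]) auto
  qed
qed

text \<open>Both strips around the integer corner rectangle get a width \<open>g\<close> between \<open>u = x
powr (3/4)\<close> and \<open>u + 1\<close>. This balances the sawtooth term \<open>x / sqrt
g\<close>, which decreases with \<open>g\<close>, against the term \<open>g powr (5/6)\<close> for
the four ends.\<close>

lemma rectangle_cover_from_trapezoids:
  assumes "trapezoid_bound C \<gamma>" "0 < C" "0 \<le> \<gamma>" "\<gamma> \<le> 1"
  shows "\<forall>\<^sub>F x in at_top. \<forall>y. x powr (3/4) \<le> y \<longrightarrow>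
    coverable ({0..x} \<times> {0..y})
      (x * y + (3 / 2) * (x + y) * x powr (- 3/8) + 5 * C * x powr (3/4 * \<gamma>))"
proof -
  obtain g0 where g0: "\<And>g L. g0 \<le> g \<Longrightarrow> 6 * sqrt g \<le> L \<Longrightarrow>
      coverable ({0..L} \<times> {0..g}) (L * g + L * ((3 / 2) / sqrt g) + 2 * (C * g powr \<gamma>))"
    using strip_cover_from_trapezoids[OF assms(1)] unfolding eventually_at_top_linorder by blast
  have "\<forall>\<^sub>F x in at_top. g0 \<le> x powr (3/4)" by real_asymp
  moreover have "\<forall>\<^sub>F x::real in at_top. 6 * sqrt (x powr (3/4) + 1) \<le> x - x powr (3/4) - 1" by real_asymp
  moreover have "\<forall>\<^sub>F x::real in at_top. 6 * sqrt (x powr (3/4) + 1) \<le> x powr (3/4)" by real_asymp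
  moreover have "\<forall>\<^sub>F x::real in at_top. 4 \<le> x powr (3/4)" by real_asymp
  ultimately show ?thesis
    using eventually_gt_at_top[of 1]
  proof eventually_elim
    case (elim x)
    define u where "u = x powr (3/4)"
    have u: "g0 \<le> u" "6 * sqrt (u + 1) \<le> x - u - 1" "6 * sqrt (u + 1) \<le> u" "4 \<le> u"
      using elim by (simp_all only: u_def)
    have sqrt_u: "sqrt u = x powr (3/8)"
      unfolding u_def by (simp add: powr_half_sqrt[symmetric] powr_powr)
    have s0: "0 \<le> sqrt (u + 1)" using u by simp
    show ?case
    proof (intro allI impI)
      fix y assume "x powr (3/4) \<le> y"
      then have y: "u \<le> y" by (simp only: u_def)
      have split: "\<exists>k g. z = real k + g \<and> u \<le> g \<and> g \<le> u + 1" if "u \<le> z" for z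
      proof -
        have "real (nat \<lfloor>z - u\<rfloor>) = of_int \<lfloor>z - u\<rfloor>" using that by (intro of_nat_nat) simp
        then show ?thesis
          by (intro exI[of _ "nat \<lfloor>z - u\<rfloor>"] exI[of _ "z - real (nat \<lfloor>z - u\<rfloor>)"]) linarith
      qed
      have "u \<le> x" using u s0 by linarith
      then obtain k g where k: "x = real k + g" "u \<le> g" "g \<le> u + 1" using split by blast
      obtain m g' where m: "y = real m + g'" "u \<le> g'" "g' \<le> u + 1" using split[OF y] by blast
      have strip: "coverable ({0..L} \<times> {0..f}) (L * f + (L * ((3 / 2) / sqrt u) + 5 / 2 * C * u powr \<gamma>))"
        if f: "u \<le> f" "f \<le> u + 1" and L: "6 * sqrt (u + 1) \<le> L" for f L
      proof -
        have sf: "sqrt f \<le> sqrt (u + 1)" "sqrt u \<le> sqrt f" "0 < sqrt u" using f u by auto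
        have L0: "0 \<le> L" using L s0 by linarith
        have "coverable ({0..L} \<times> {0..f}) (L * f + L * ((3 / 2) / sqrt f) + 2 * (C * f powr \<gamma>))"
          using u f L sf by (intro g0) linarith+
        moreover have "L * ((3 / 2) / sqrt f) \<le> L * ((3 / 2) / sqrt u)"
          using sf L0 by (intro mult_left_mono divide_left_mono mult_pos_pos) auto
        \<comment> \<open>From \<open>f \<le> u + 1\<close> and \<open>4 \<le> u\<close>; four ends together then
          cost at most \<open>5 * C * u powr \<gamma>\<close>.\<close>
        moreover have "f powr \<gamma> \<le> 5 / 4 * u powr \<gamma>"
        proof -
          have "f powr \<gamma> \<le> (5 / 4 * u) powr \<gamma>" using f u assms by (intro powr_mono2) auto
          also have "\<dots> = (5 / 4) powr \<gamma> * u powr \<gamma>" by (rule powr_mult)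
          also have "\<dots> \<le> (5 / 4) powr 1 * u powr \<gamma>"
            using assms by (intro mult_right_mono powr_mono) auto
          finally show ?thesis by simp
        qed
        then have "2 * (C * f powr \<gamma>) \<le> 5 / 2 * C * u powr \<gamma>"
          using mult_left_mono[of "f powr \<gamma>" "5 / 4 * u powr \<gamma>" "2 * C"] assms(2) by simp
        ultimately show ?thesis
          by (rule_tac coverable_mono[OF _ subset_refl]) auto
      qed
      have cov: "coverable ({0..x} \<times> {0..y}) (x * y
          + (y * ((3 / 2) / sqrt u) + 5 / 2 * C * u powr \<gamma>)
          + (real k * ((3 / 2) / sqrt u) + 5 / 2 * C * u powr \<gamma>))"
        by (rule coverable_rectangle_split[OF k(1) m(1) _ _ strip strip])
           (use k m u y s0 in linarith)+
      have le: "(y * ((3 / 2) / sqrt u) + 5 / 2 * C * u powr \<gamma>)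
          + (real k * ((3 / 2) / sqrt u) + 5 / 2 * C * u powr \<gamma>)
          \<le> (3 / 2) * (x + y) * x powr (- 3/8) + 5 * C * x powr (3/4 * \<gamma>)"
      proof -
        have "real k \<le> x" using k u by simp
        then have e1: "real k * ((3 / 2) / sqrt u) \<le> x * ((3 / 2) / sqrt u)"
          using u by (intro mult_right_mono) auto
        have e2: "(3 / 2) * (x + y) * x powr (- 3/8) = x * ((3 / 2) / sqrt u) + y * ((3 / 2) / sqrt u)"
        proof -
          have r: "x powr (- 3/8) = inverse (sqrt u)"
            unfolding sqrt_u by (simp add: powr_minus[symmetric])
          have "(3 / 2) / sqrt u = (3 / 2) * inverse (sqrt u)" by (rule divide_inverse)
          then show ?thesis unfolding r by (simp only:) (simp add: algebra_simps)
        qed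
        have e3: "u powr \<gamma> = x powr (3/4 * \<gamma>)"
          unfolding u_def by (simp only: powr_powr)
        have e4: "5 * C * u powr \<gamma> = 5 / 2 * C * u powr \<gamma> + 5 / 2 * C * u powr \<gamma>"
          by simp
        have "Y + P + (A + P) \<le> B + Y + (P + P)" if "A \<le> B" for A B Y P :: real
          using that by simp
        then show ?thesis
          unfolding e2 e3[symmetric] e4 using e1 .
      qed
      show "coverable ({0..x} \<times> {0..y})
          (x * y + (3 / 2) * (x + y) * x powr (- 3/8) + 5 * C * x powr (3/4 * \<gamma>))"
        by (rule coverable_mono[OF cov subset_refl]) (use add_left_mono[OF le] in \<open>simp only: add.assoc\<close>)
    qed
  qed
qed

lemma rectangle_bound_from_trapezoids:
  assumes "trapezoid_bound C \<gamma>" "0 < C" "0 \<le> \<gamma>" "\<gamma> \<le> 1" "5/8 \<le> \<beta>" "3/4 * \<gamma> \<le> \<beta>"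
  shows "rectangle_bound \<beta>"
  unfolding rectangle_bound_def
proof (intro exI conjI)
  show "0 < 5 * C + 33 / 2" using assms(2) by simp
  show "\<forall>\<^sub>F x in at_top. \<forall>y. x powr (3/4) \<le> y \<and> y \<le> 10 * x \<longrightarrow>
     coverable ({0..x} \<times> {0..y}) (x * y + (5 * C + 33 / 2) * x powr \<beta>)"
    using rectangle_cover_from_trapezoids[OF assms(1-4)] eventually_ge_at_top[of 1]
  proof eventually_elim
    case (elim x)
    show ?case
    proof (intro allI impI, elim conjE)
      fix y assume y: "x powr (3/4) \<le> y" "y \<le> 10 * x"
      have "(3 / 2) * (x + y) * x powr (- 3/8) \<le> (33 / 2 * x) * x powr (- 3/8)"
        using y(2) by (intro mult_right_mono) auto
      also have "\<dots> = 33 / 2 * x powr (5/8)"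
        using elim(2) powr_add[of x 1 "- 3/8"] by simp
      also have "\<dots> \<le> 33 / 2 * x powr \<beta>"
        using elim(2) assms(5) by (intro mult_left_mono powr_mono) auto
      finally have 1: "(3 / 2) * (x + y) * x powr (- 3/8) \<le> 33 / 2 * x powr \<beta>" .
      have 2: "5 * C * x powr (3/4 * \<gamma>) \<le> 5 * C * x powr \<beta>"
        using elim(2) assms(2,6) by (intro mult_left_mono powr_mono) auto
      have "x * y + (3 / 2) * (x + y) * x powr (- 3/8) + 5 * C * x powr (3/4 * \<gamma>)
          \<le> x * y + (5 * C + 33 / 2) * x powr \<beta>"
        using add_mono[OF 1 2] by (simp only: distrib_right)
      then show "coverable ({0..x} \<times> {0..y}) (x * y + (5 * C + 33 / 2) * x powr \<beta>)"
        by (rule coverable_mono[OF elim(1)[rule_format, OF y(1)] subset_refl])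
    qed
  qed
qed

text \<open>A rectangle bound \<open>\<beta>\<close> gives a trapezoid bound \<open>max (5/6) ((1 + \<beta>) /
2)\<close>, and a trapezoid bound \<open>\<gamma>\<close> gives the rectangle bound \<open>max
(5/8) (3/4 * \<gamma>)\<close>. Starting from the trivial \<open>\<beta> = 1\<close>, two rounds
give \<open>\<beta> = 3/4\<close> and \<open>\<beta> = 21/32\<close>. The latter is below
\<open>2/3\<close>, and this is what matters.\<close>

lemma rectangle_bound_21_32: "rectangle_bound (21/32)"
proof -
  have "\<exists>C>0. trapezoid_bound C 1"
  proof -
    obtain C where C: "0 < C" "\<forall>\<^sub>F x in at_top. \<forall>y. x powr (3/4) \<le> y \<and> y \<le> 10 * x \<longrightarrow>
        coverable ({0..x} \<times> {0..y}) (x * y + C * x powr 1)"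
      using rectangle_bound_trivial unfolding rectangle_bound_def by blast
    have "trapezoid_bound (3 * C) 1"
      by (rule trapezoid_bound_from_rectangles[OF C]) (use C(1) in \<open>simp; real_asymp\<close>)+
    then show ?thesis using C(1) by (intro exI[of _ "3 * C"]) simp
  qed
  then have "rectangle_bound (3/4)"
    using rectangle_bound_from_trapezoids[of _ 1 "3/4"] by auto
  then obtain C where C: "0 < C" "\<forall>\<^sub>F x in at_top. \<forall>y. x powr (3/4) \<le> y \<and> y \<le> 10 * x \<longrightarrow>
      coverable ({0..x} \<times> {0..y}) (x * y + C * x powr (3/4))"
    unfolding rectangle_bound_def by blast
  have "trapezoid_bound (3 * C) (7/8)"
    by (rule trapezoid_bound_from_rectangles[OF C]) (use C(1) in \<open>simp; real_asymp\<close>)+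
  then show ?thesis
    using rectangle_bound_from_trapezoids[of "3 * C" "7/8" "21/32"] C(1) by simp
qed

text \<open>As \<open>21/32 < 2/3\<close>, the rectangles in the layers only contribute a lower order term,
and the unknown constant disappears: the leading term comes from \<open>2 * sqrt x\<close> thin
trapezoids with excess \<open>5 * x powr (1/3)\<close> each.\<close>

lemma trapezoid_bound_five_sixths: "trapezoid_bound 11 (5/6)"
proof -
  obtain C where C: "0 < C" "\<forall>\<^sub>F x in at_top. \<forall>y. x powr (3/4) \<le> y \<and> y \<le> 10 * x \<longrightarrow>
      coverable ({0..x} \<times> {0..y}) (x * y + C * x powr (21/32))"
    using rectangle_bound_21_32 unfolding rectangle_bound_def by blast
  show ?thesis
    by (rule trapezoid_bound_from_rectangles[OF C]) (use C(1) in \<open>simp; real_asymp\<close>)+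
qed

section \<open>From covering counts to covering waste\<close>

lemma sqrt2_bounds: "7/5 \<le> sqrt (2::real)" "sqrt (2::real) \<le> 3/2"
  by (rule real_le_rsqrt, simp add: power2_eq_square) (rule real_le_lsqrt, simp_all add: power2_eq_square)

text \<open>The four ends contribute \<open>5 * 11 = 55\<close> and the sawtooth along the two strips
\<open>(3/2) * (1 + c)\<close>. For \<open>c \<le> 7\<close> this is below the claimed constant,
although \<open>3/2\<close> exceeds the coefficient \<open>sqrt 2\<close> of \<open>c\<close>.\<close>

lemma rectangle_waste:
  assumes "c \<le> 7"
  shows "\<forall>\<^sub>F x in at_top. \<forall>y T. x powr (3/4) \<le> y \<and> y \<le> c * x \<and> is_rectangle x y T \<longrightarrow>
    covering_waste T \<le> ((15 + c) * sqrt 2 + 38) * x powr (5/8)"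
proof -
  have "\<forall>\<^sub>F x in at_top. \<forall>y. x powr (3/4) \<le> y \<longrightarrow> coverable ({0..x} \<times> {0..y})
      (x * y + (3 / 2) * (x + y) * x powr (- 3/8) + 55 * x powr (5/8))"
    using rectangle_cover_from_trapezoids[OF trapezoid_bound_five_sixths] by simp
  then show ?thesis
    using eventually_ge_at_top[of 1]
  proof eventually_elim
    case (elim x)
    show ?case
    proof (intro allI impI, elim conjE)
      fix y T assume y: "x powr (3/4) \<le> y" "y \<le> c * x" and T: "is_rectangle x y T"
      have "covering_waste T \<le> x * y + (3 / 2) * (x + y) * x powr (- 3/8) + 55 * x powr (5/8) - measure lebesgue T"
        using elim y(1) by (intro covering_waste_le coverable_placed_rectangle[OF _ T]) simp
      also have "measure lebesgue T = x * y"
        using y(1) elim(2) by (intro measure_rectangle[OF T]) (auto intro: order_trans[OF powr_ge_zero])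
      also have "x * y + (3 / 2) * (x + y) * x powr (- 3/8) + 55 * x powr (5/8) - x * y
          \<le> (3 / 2) * ((1 + c) * x) * x powr (- 3/8) + 55 * x powr (5/8)"
      proof -
        have "(3 / 2) * (x + y) * x powr (- 3/8) \<le> (3 / 2) * ((1 + c) * x) * x powr (- 3/8)"
          using y(2) by (intro mult_right_mono) (simp_all add: distrib_right)
        then show ?thesis by linarith
      qed
      also have "\<dots> = ((3 / 2) * (1 + c) + 55) * x powr (5/8)"
        using elim(2) powr_add[of x 1 "- 3/8"] by (simp add: distrib_right)
      also have "\<dots> \<le> ((15 + c) * sqrt 2 + 38) * x powr (5/8)"
      proof (rule mult_right_mono)
        have "(7 - c) * sqrt 2 \<le> (7 - c) * (3/2)"
          using assms sqrt2_bounds(2) by (intro mult_left_mono) auto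
        then have "7 * sqrt 2 + (3/2) * c \<le> 21/2 + c * sqrt 2"
          by (simp add: algebra_simps)
        moreover have "(3 / 2) * (1 + c) + 55 \<le> 15 * s + d + 38"
          if "7 * s + (3/2) * c \<le> 21/2 + d" "7/5 \<le> s" for s d :: real
          using that by argo
        ultimately show "(3 / 2) * (1 + c) + 55 \<le> (15 + c) * sqrt 2 + 38"
          unfolding distrib_right using sqrt2_bounds(1) by blast
      qed simp
      finally show "covering_waste T \<le> ((15 + c) * sqrt 2 + 38) * x powr (5/8)" .
    qed
  qed
qed

lemma right_trapezoid_waste:
  assumes "coverable (trapezoid a h (tan \<theta>)) (a * h + tan \<theta> * h\<^sup>2 / 2 + E)"
    and "0 \<le> a" "0 \<le> h" "0 \<le> tan \<theta>"
  shows "covering_waste (right_trapezoid p a h \<theta>) \<le> E"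
  using covering_waste_le[OF coverable_right_trapezoid[OF assms(1)], of p]
    measure_right_trapezoid_ge[OF assms(2-4), of p] by linarith

lemma asymp_equiv_between:
  fixes f g :: "real \<Rightarrow> real"
  assumes "f \<sim>[at_top] g" "\<forall>\<^sub>F x in at_top. 0 < g x" "a < 1" "1 < b"
  shows "\<forall>\<^sub>F x in at_top. a * g x \<le> f x \<and> f x \<le> b * g x"
proof -
  have "((\<lambda>x. f x / g x) \<longlongrightarrow> 1) at_top"
  proof (rule Lim_transform_eventually[OF asymp_equivD[OF assms(1)]])
    show "\<forall>\<^sub>F x in at_top. (if f x = 0 \<and> g x = 0 then 1 else f x / g x) = f x / g x"
      using assms(2) by eventually_elim auto
  qed
  then have "\<forall>\<^sub>F x in at_top. a < f x / g x" "\<forall>\<^sub>F x in at_top. f x / g x < b"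
    using order_tendstoD assms(3,4) by blast+
  then show ?thesis
    using assms(2) by eventually_elim (simp add: pos_less_divide_eq pos_divide_less_eq less_imp_le)
qed

lemma slope_between:
  assumes "\<forall>\<^sub>F x in at_top. 0 < \<theta> x \<and> \<theta> x < sqrt 2 * x powr (-1/2)"
  shows "\<forall>\<^sub>F x in at_top. 0 < tan (\<theta> x) \<and> tan (\<theta> x) \<le> (3/2) / sqrt x"
proof -
  \<comment> \<open>Any number strictly between \<open>sqrt 2\<close> and \<open>3/2\<close> would do in
    place of \<open>10/7\<close>.\<close>
  have "\<forall>\<^sub>F x::real in at_top. tan (10/7 * x powr (-1/2)) \<le> (3/2) / sqrt x" by real_asymp
  moreover have "\<forall>\<^sub>F x::real in at_top. 10/7 * x powr (-1/2) < pi / 2"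
    by real_asymp
  ultimately show ?thesis
    using assms
  proof eventually_elim
    case (elim x)
    have "sqrt 2 \<le> (10/7 :: real)" by (rule real_le_lsqrt) (simp_all add: power2_eq_square)
    then have "sqrt 2 * x powr (-1/2) \<le> 10/7 * x powr (-1/2)"
      by (intro mult_right_mono) auto
    then have l: "\<theta> x < 10/7 * x powr (-1/2)" using elim by linarith
    then have "tan (\<theta> x) < tan (10/7 * x powr (-1/2))"
      using elim by (intro tan_monotone) linarith+
    then show ?case using elim l tan_gt_zero[of "\<theta> x"] by linarith
  qed
qed

lemma tall_trapezoid_waste:
  assumes "w \<sim>[at_top] (\<lambda>x. 2 * x powr (1/2))"
    and "\<forall>\<^sub>F x in at_top. 0 < \<theta> x \<and> \<theta> x < sqrt 2 * x powr (-1/2)"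
  shows "\<forall>\<^sub>F x in at_top. \<forall>p. covering_waste (right_trapezoid p (w x) x (\<theta> x))
    \<le> (19/2 + 7/2 * sqrt 2) * x powr (5/6)"
proof -
  have "\<forall>\<^sub>F x::real in at_top. 0 < 2 * x powr (1/2)" by real_asymp
  from asymp_equiv_between[OF assms(1) this, of "95/100" "105/100"]
  have "\<forall>\<^sub>F x in at_top. 95/100 * (2 * x powr (1/2)) \<le> w x \<and> w x \<le> 105/100 * (2 * x powr (1/2))"
    by simp
  then show ?thesis
    using slope_between[OF assms(2)] trapezoid_bound_five_sixths[unfolded trapezoid_bound_def] eventually_gt_at_top[of 0]
  proof eventually_elim
    case (elim x)
    have r: "x powr (1/2) = sqrt x" using elim(4) by (simp add: powr_half_sqrt)
    have w: "19/10 * sqrt x \<le> w x" "w x \<le> 21/10 * sqrt x"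
      using elim(1) unfolding r by auto
    have "0 \<le> w x" using w(1) elim(4) by (rule_tac order_trans[OF _ w(1)]) simp
    show ?case
    proof
      fix p
      have "covering_waste (right_trapezoid p (w x) x (\<theta> x)) \<le> 11 * x powr (5/6)"
        using elim w \<open>0 \<le> w x\<close> by (intro right_trapezoid_waste elim(3)[rule_format]) auto
      also have "\<dots> \<le> (19/2 + 7/2 * sqrt 2) * x powr (5/6)"
        using sqrt2_bounds by (intro mult_right_mono) auto
      finally show "covering_waste (right_trapezoid p (w x) x (\<theta> x)) \<le> (19/2 + 7/2 * sqrt 2) * x powr (5/6)" .
    qed
  qed
qed

lemma low_trapezoid_waste:
  assumes "h \<sim>[at_top] (\<lambda>x. 1/2 * x powr (1/2))"
    and "\<forall>\<^sub>F x in at_top. 0 < \<theta> x \<and> \<theta> x < sqrt 2 * x powr (-1/2)"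
  shows "\<forall>\<^sub>F x in at_top. \<forall>p. covering_waste (right_trapezoid p
      (of_int \<lfloor>x powr (1/3) - sqrt 2 * x powr (1/6)\<rfloor>) (h x) (\<theta> x))
    \<le> (19/4 + 7/4 * sqrt 2) * x powr (1/3)"
proof -
  have "\<forall>\<^sub>F x::real in at_top. 0 < 1/2 * x powr (1/2)" by real_asymp
  from asymp_equiv_between[OF assms(1) this, of "8/10" "12/10"]
  have "\<forall>\<^sub>F x in at_top. 8/10 * (1/2 * x powr (1/2)) \<le> h x \<and> h x \<le> 12/10 * (1/2 * x powr (1/2))"
    by simp
  moreover have "\<forall>\<^sub>F x::real in at_top. 20 \<le> x powr (1/6)" by real_asymp
  ultimately show ?thesis
    using slope_between[OF assms(2)] eventually_gt_at_top[of 0]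
  proof eventually_elim
    case (elim x)
    define q where "q = x powr (1/6)"
    have q3: "q ^ 3 = x powr (1/2)" and q2: "q\<^sup>2 = x powr (1/3)"
      using elim(4) by (simp_all add: q_def powr_power)
    have q3': "q ^ 3 = sqrt x" using q3 elim(4) by (simp add: powr_half_sqrt)
    have q: "20 \<le> q" using elim(2) by (simp only: q_def)
    have qq: "20 * q \<le> q\<^sup>2" using q by (simp add: power2_eq_square)
    have sq: "q \<le> sqrt 2 * q" "sqrt 2 * q \<le> 3/2 * q"
      using q sqrt2_bounds by (auto intro: mult_right_mono)
    define a where "a = nat \<lfloor>q\<^sup>2 - sqrt 2 * q\<rfloor>"
    have ra: "real a = of_int \<lfloor>q\<^sup>2 - sqrt 2 * q\<rfloor>"
    proof -
      have "0 \<le> q\<^sup>2 - sqrt 2 * q" using qq q sq by linarith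
      then show ?thesis unfolding a_def by (intro of_nat_nat) simp
    qed
    have a: "q\<^sup>2 / 2 \<le> real a + 1" "real a + 1 \<le> q\<^sup>2"
      unfolding ra using qq q sq by linarith+
    have h: "4/10 * q ^ 3 \<le> h x" "h x \<le> 6/10 * q ^ 3" using elim(1) unfolding q3 by auto
    have "0 < q ^ 3" using q by simp
    then have "0 \<le> h x" using h(1) by linarith
    show ?case
    proof
      fix p
      have "covering_waste (right_trapezoid p (real a) (h x) (\<theta> x)) \<le> 5 * q\<^sup>2"
        using elim(3) \<open>0 \<le> h x\<close>
        by (intro right_trapezoid_waste thin_trapezoid_excess q a h) (auto simp: q3')
      also have "\<dots> \<le> (19/4 + 7/4 * sqrt 2) * q\<^sup>2"
        using sqrt2_bounds by (intro mult_right_mono) auto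
      finally show "covering_waste (right_trapezoid p
          (of_int \<lfloor>x powr (1/3) - sqrt 2 * x powr (1/6)\<rfloor>) (h x) (\<theta> x))
          \<le> (19/4 + 7/4 * sqrt 2) * x powr (1/3)"
        unfolding ra unfolding q2 unfolding q_def .
    qed
  qed
qed

lemma square_waste:
  "\<forall>\<^sub>F x::real in at_top. \<forall>T. is_square x T \<longrightarrow>
    covering_waste T \<le> (16 * sqrt 2 + 38) * x powr (5/8)"
proof -
  have "\<forall>\<^sub>F x::real in at_top. x powr (3/4) \<le> x" by real_asymp
  then show ?thesis
    using rectangle_waste[of 1, simplified] by eventually_elim auto
qed

theorem theorem2:
  shows
    "(\<forall>c::real. c \<le> 7 \<longrightarrow>
        (\<forall>\<^sub>F x::real in at_top. \<forall>x' T. x powr (3/4) \<le> x' \<and> x' \<le> c * x \<and> is_rectangle x x' T \<longrightarrow>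
           covering_waste T \<le> ((15 + c) * sqrt 2 + 38) * x powr (5/8)))
     \<and>
     (\<forall>(x' :: real \<Rightarrow> real) \<theta> :: real \<Rightarrow> real.
        asymp_equiv x' at_top (\<lambda>x. 2 * x powr (1/2)) \<and>
        (\<forall>\<^sub>F x in at_top. 0 < \<theta> x \<and> \<theta> x < sqrt 2 * x powr (-1/2)) \<longrightarrow>
        (\<forall>\<^sub>F x in at_top. \<forall>p.
           covering_waste (right_trapezoid p (x' x) x (\<theta> x))
             \<le> (19/2 + 7/2 * sqrt 2) * x powr (5/6)))
     \<and>
     (\<forall>(h :: real \<Rightarrow> real) \<theta> :: real \<Rightarrow> real.
        asymp_equiv h at_top (\<lambda>x. 1/2 * x powr (1/2)) \<and>
        (\<forall>\<^sub>F x in at_top. 0 < \<theta> x \<and> \<theta> x < sqrt 2 * x powr (-1/2)) \<longrightarrow>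
        (\<forall>\<^sub>F x in at_top. \<forall>p.
           covering_waste (right_trapezoid p
               (of_int \<lfloor>x powr (1/3) - sqrt 2 * x powr (1/6)\<rfloor>) (h x) (\<theta> x))
             \<le> (19/4 + 7/4 * sqrt 2) * x powr (1/3)))
     \<and>
     (\<forall>\<^sub>F x::real in at_top. \<forall>T. is_square x T \<longrightarrow>
        covering_waste T \<le> (16 * sqrt 2 + 38) * x powr (5/8))"
proof (intro conjI allI impI)
  fix c :: real assume "c \<le> 7"
  then show "\<forall>\<^sub>F x::real in at_top. \<forall>x' T. x powr (3/4) \<le> x' \<and> x' \<le> c * x \<and> is_rectangle x x' T \<longrightarrow>
      covering_waste T \<le> ((15 + c) * sqrt 2 + 38) * x powr (5/8)"
    by (rule rectangle_waste)
qed (use tall_trapezoid_waste low_trapezoid_waste square_waste in blast)+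

end
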